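(* Assume (A0)–(A3) as in the context, $r>1$, and that (M$_p$) holds with some $p>1+r$. For $x\in\mathbb{S}$ set $\pi(x):=\mathbb{E}[\ell_1(x)]/\mathbb{E}[\eta_1]$. Then $\pi(x)>0$ for all $x\in\mathbb{S}$, $\sum_{x\in\mathbb{S}}\pi(x)=1$, and for every $x\in\mathbb{S}$, $t^{-1}L_t(x)\to\pi(x)$ a.s. and in $L^q$ for every $q\ge1$. Moreover, if in addition the distribution of $\eta_1$ is not supported on $k\mathbb{N}$ for any integer $k>1$, then $\lim_{t\to\infty}\mathbb{P}[X_t=x]=\pi(x)$ for every $x\in\mathbb{S}$.
   Context: $\mathbb{N}=\{1,2,\dots\}$. (A0): $\mathbb{S}$ is a locally finite (every bounded set meets it in finitely many points), unbounded subset of $[0,\infty)$ with $0\in\mathbb{S}$; $(X_t)_{t\in\mathbb{N}}$ is an $\mathbb{S}$-valued process adapted to a filtration $(\mathcal{F}_t)_{t\in\mathbb{N}}$ with $\mathbb{P}[X_1=0]=1$. (A1): for each $x,y\in\mathbb{S}$ there exist $m(x,y)\in\mathbb{N}$, $\varphi(x,y)>0$ with $\mathbb{P}[X_{t+m(X_t,y)}=y\mid\mathcal{F}_t]\ge\varphi(X_t,y)$ a.s. for all $t$. Write $\Delta_t:=X_{t+1}-X_t$. (A2): there are $c\in\mathbb{R}$, $s^2\in(0,\infty)$ with, as $X_t\to\infty$, $\mathbb{E}[\Delta_t\mid\mathcal{F}_t]=cX_t^{-1}+o(X_t^{-1}(\log X_t)^{-1})$ and $\mathbb{E}[\Delta_t^2\mid\mathcal{F}_t]=s^2+o((\log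 X_t)^{-1})$ a.s., where the implicit constants in $o(\cdot)$ are non-random and uniform in $t$ and in the sample point. Set $r:=-2c/s^2$. Excursions: $\tau_0:=1$, $\tau_n:=\min\{t>\tau_{n-1}:X_t=0\}$ ($\min\emptyset=\infty$), $\eta_n:=\tau_n-\tau_{n-1}$, $\mathcal{E}_n:=(X_t)_{\tau_{n-1}\le t\le\tau_n-1}$, $N:=\min\{n\in\mathbb{N}:\tau_n=\infty\}$. (A3): (a) on $\{N=\infty\}$, $(\mathcal{E}_n)_{n\in\mathbb{N}}$ is i.i.d.; (b) $\mathbb{P}[\eta_{n+1}<\infty\mid\tau_n<\infty]=\mathbb{P}[\eta_1<\infty]$ for all $n$. (M$_p$): there exist $\delta>0$, $C<\infty$ with $\mathbb{E}[|\Delta_t|^p\mid\mathcal{F}_t]\le C(1+X_t)^{p-2-\delta}$ a.s. for all $t$. Occupation times: $L_t(x):=\sum_{s=1}^t\mathbf{1}\{X_s=x\}$ and, for the $n$th excursion, $\ell_n(x):=\sum_{t=\tau_{n-1}}^{\tau_n-1}\mathbf{1}\{X_t=x\}$. *)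

theory Defs
  imports "HOL-Probability.Probability"
begin

fun tau :: "(nat \<Rightarrow> 'a \<Rightarrow> real) \<Rightarrow> nat \<Rightarrow> 'a \<Rightarrow> enat" where
  "tau X 0 \<omega> = 1"
| "tau X (Suc n) \<omega> =
     (case tau X n \<omega> of
        \<infinity> \<Rightarrow> \<infinity>
      | enat k \<Rightarrow> (if \<exists>t>k. X t \<omega> = 0 then enat (LEAST t. k < t \<and> X t \<omega> = 0) else \<infinity>))"

definition eta :: "(nat \<Rightarrow> 'a \<Rightarrow> real) \<Rightarrow> nat \<Rightarrow> 'a \<Rightarrow> enat" where
  "eta X n \<omega> = tau X n \<omega> - tau X (n - 1) \<omega>"

definition Nexc :: "(nat \<Rightarrow> 'a \<Rightarrow> real) \<Rightarrow> 'a \<Rightarrow> enat" where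
  "Nexc X \<omega> = (if \<exists>n\<ge>1. tau X n \<omega> = \<infinity> then enat (LEAST n. 1 \<le> n \<and> tau X n \<omega> = \<infinity>) else \<infinity>)"

text \<open>The n-th excursion (X_t), tau (n-1) \<le> t \<le> tau n - 1, as a path indexed from 0:
  entry k is Some (X (tau (n-1) + k)) while tau (n-1) + k < tau n, and None afterwards.\<close>
definition excursion :: "(nat \<Rightarrow> 'a \<Rightarrow> real) \<Rightarrow> nat \<Rightarrow> 'a \<Rightarrow> nat \<Rightarrow> real option" where
  "excursion X n \<omega> k =
     (case tau X (n - 1) \<omega> of
        \<infinity> \<Rightarrow> None
      | enat a \<Rightarrow> (if enat (a + k) < tau X n \<omega> then Some (X (a + k) \<omega>) else None))"

definition path_space :: "(nat \<Rightarrow> real option) measure" where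
  "path_space = PiM UNIV (\<lambda>_. count_space UNIV)"

definition occ :: "(nat \<Rightarrow> 'a \<Rightarrow> real) \<Rightarrow> nat \<Rightarrow> real \<Rightarrow> 'a \<Rightarrow> nat" where
  "occ X t x \<omega> = card {s \<in> {1..t}. X s \<omega> = x}"

definition ell :: "(nat \<Rightarrow> 'a \<Rightarrow> real) \<Rightarrow> nat \<Rightarrow> real \<Rightarrow> 'a \<Rightarrow> ennreal" where
  "ell X n x \<omega> = (\<Sum>t. if tau X (n - 1) \<omega> \<le> enat t \<and> enat t < tau X n \<omega> \<and> X t \<omega> = x then 1 else 0)"

definition stat_pi :: "'a measure \<Rightarrow> (nat \<Rightarrow> 'a \<Rightarrow> real) \<Rightarrow> real \<Rightarrow> real" where
  "stat_pi M X x = enn2real ((\<integral>\<^sup>+ \<omega>. ell X 1 x \<omega> \<partial>M) / (\<integral>\<^sup>+ \<omega>. ennreal_of_enat (eta X 1 \<omega>) \<partial>M))"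

end

theory Submission
  imports Defs
begin

text \<open>
  The squared process has drift tending to \<open>2c + s\<^sup>2 < 0\<close>, and by (A1) every visit to a bounded set is followed
  with probability bounded below by a visit to 0 within a bounded time; hence \<open>E \<eta>\<^sub>1 < \<infinity>\<close>. By (A3b) all
  return times are then finite almost surely, so conditioning on \<open>N = \<infinity>\<close> is void and the excursions
  are i.i.d. The strong law applied to their lengths and occupation times gives the almost
  sure limit, and bounded convergence the \<open>L\<^sup>q\<close> limit. Decomposing \<open>P[X\<^sub>t = x]\<close> at the last visit to 0 before \<open>t\<close> yields a
  convolution with the renewal sequence of \<open>\<eta>\<^sub>1\<close>, which converges to \<open>1 / E \<eta>\<^sub>1\<close> by the
  theorem of Erdos, Feller and Pollard.
\<close>

section \<open>The renewal theorem\<close>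

lemma additive_closed_cofinite:
  fixes T :: "nat set"
  assumes zero: "0 \<in> T" and add: "\<And>a b. a \<in> T \<Longrightarrow> b \<in> T \<Longrightarrow> a + b \<in> T"
    and gcd: "\<And>d. 1 < d \<Longrightarrow> \<exists>t\<in>T. \<not> d dvd t"
  shows "\<exists>K. \<forall>n\<ge>K. n \<in> T"
proof -
  have mult: "q * a \<in> T" if "a \<in> T" for q a
    by (induction q) (use that zero add in auto)
  define P where "P d \<longleftrightarrow> d > 0 \<and> (\<exists>b\<in>T. b + d \<in> T)" for d
  obtain t where "t \<in> T" "\<not> 2 dvd t"
    using gcd[of 2] by auto
  then have "P t"
    unfolding P_def using zero by (auto intro!: gr0I bexI[of _ 0])
  define d where "d = (LEAST d. P d)"
  have "P d" unfolding d_def by (rule LeastI) (fact \<open>P t\<close>)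
  then obtain b where b: "d > 0" "b \<in> T" "b + d \<in> T"
    by (auto simp: P_def)
  have "d dvd t" if "t \<in> T" for t
  proof (rule ccontr)
    assume "\<not> d dvd t"
    then have m: "t mod d > 0" "t mod d < d"
      using b by (auto simp: dvd_eq_mod_eq_0)
    have "t + (t div d) * b \<in> T" "(t div d) * (b + d) \<in> T"
      using add[OF that mult[OF b(2)]] mult[OF b(3)] by blast+
    moreover have "t + (t div d) * b = (t div d) * (b + d) + t mod d"
      using div_mult_mod_eq[of t d] by (simp add: algebra_simps)
    ultimately have "(t div d) * (b + d) + t mod d \<in> T" "(t div d) * (b + d) \<in> T"
      by simp_all
    then have "P (t mod d)"
      unfolding P_def using m by blast
    then show False
      using m not_less_Least[of "t mod d" P] by (simp add: d_def)
  qed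
  then have "d = 1"
    using gcd[of d] b by (cases "d = 1") auto
  then have b1: "b + 1 \<in> T" using b by simp
  have "n \<in> T" if "n \<ge> b * b" for n
  proof (cases "b = 0")
    case True
    then show ?thesis using mult[OF b1, of n] by simp
  next
    case False
    then have "n mod b < b" by simp
    moreover have "n div b \<ge> b"
      using that False by (metis div_le_mono nonzero_mult_div_cancel_right)
    ultimately have "(n div b - n mod b) * b + (n mod b) * b = (n div b) * b"
      by (simp add: add_mult_distrib[symmetric])
    then have "(n div b - n mod b) * b + (n mod b) * (b + 1) = n"
      unfolding add_mult_distrib2 mult_1_right using div_mult_mod_eq[of n b] by linarith
    then show ?thesis
      using mult b b1 add by metis
  qed
  then show ?thesis by blast
qed

lemma convolution_tendsto:
  fixes a u :: "nat \<Rightarrow> real" and h :: "nat \<Rightarrow> nat"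
  assumes a: "summable (\<lambda>k. \<bar>a k\<bar>)" and u: "\<And>n. \<bar>u n\<bar> \<le> B"
    and h: "filterlim h at_top sequentially"
    and lim: "\<And>k. (\<lambda>v. u (h v - k)) \<longlonglongrightarrow> L"
  shows "(\<lambda>v. \<Sum>k\<le>h v. a k * u (h v - k)) \<longlonglongrightarrow> (\<Sum>k. a k) * L"
proof -
  define A where "A k v = (if k \<le> h v then a k * u (h v - k) else 0)" for k v
  have "(\<lambda>v. A k v) \<longlonglongrightarrow> a k * L" for k
  proof (rule Lim_transform_eventually)
    show "(\<lambda>v. a k * u (h v - k)) \<longlonglongrightarrow> a k * L"
      by (intro tendsto_intros lim)
    have "eventually (\<lambda>v. k \<le> h v) sequentially"
      using h by (simp add: filterlim_at_top)
    then show "eventually (\<lambda>v. a k * u (h v - k) = A k v) sequentially"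
      by eventually_elim (simp add: A_def)
  qed
  moreover have "norm (A k v) \<le> \<bar>a k\<bar> * B" for k v
    using u[of 0] by (auto simp: A_def abs_mult intro!: mult_left_mono u)
  moreover have "summable (\<lambda>k. \<bar>a k\<bar> * B)"
    using a by (rule summable_mult2)
  ultimately have "(\<lambda>v. \<Sum>k. A k v) \<longlonglongrightarrow> (\<Sum>k. a k * L)"
    using tannerys_theorem[of A "\<lambda>k. a k * L" sequentially "\<lambda>k. \<bar>a k\<bar> * B"]
    by (auto simp: always_eventually)
  moreover have "(\<Sum>k. A k v) = (\<Sum>k\<le>h v. a k * u (h v - k))" for v
    by (subst suminf_finite[of "{..h v}"]) (auto simp: A_def)
  moreover have "(\<Sum>k. a k * L) = (\<Sum>k. a k) * L"
    using a summable_rabs_cancel by (intro suminf_mult2[symmetric]) auto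
  ultimately show ?thesis by simp
qed

locale renewal_sequence =
  fixes f u :: "nat \<Rightarrow> real" and \<mu> B :: real
  assumes f_nonneg: "f k \<ge> 0" and f_0: "f 0 = 0" and f_sums: "f sums 1"
    and tail_sums: "(\<lambda>k. 1 - (\<Sum>j\<le>k. f j)) sums \<mu>" and \<mu>_pos: "\<mu> > 0"
    and aperiodic: "1 < d \<Longrightarrow> \<exists>k. f k > 0 \<and> \<not> d dvd k"
    and u_bounded: "\<bar>u n\<bar> \<le> B"
    and renewal_eq: "n \<ge> 1 \<Longrightarrow> u n = (\<Sum>k\<le>n. f k * u (n - k))"
begin

lemma f_summable: "summable (\<lambda>k. \<bar>f k\<bar>)"
  using f_sums f_nonneg by (simp add: sums_iff)

lemma tail_convolution: "(\<Sum>k\<le>n. (1 - (\<Sum>j\<le>k. f j)) * u (n - k)) = u 0"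
proof (induction n)
  case 0
  then show ?case by (simp add: f_0)
next
  case (Suc n)
  let ?r = "\<lambda>k. 1 - (\<Sum>j\<le>k. f j)"
  have "(\<Sum>k\<le>Suc n. ?r k * u (Suc n - k)) = u (Suc n) + (\<Sum>k\<le>n. ?r (Suc k) * u (n - k))"
    by (subst sum.atMost_Suc_shift) (simp add: f_0)
  also have "(\<Sum>k\<le>n. ?r (Suc k) * u (n - k)) = (\<Sum>k\<le>n. ?r k * u (n - k)) - (\<Sum>k\<le>n. f (Suc k) * u (n - k))"
    by (simp add: sum_subtractf[symmetric] algebra_simps)
  also have "(\<Sum>k\<le>n. f (Suc k) * u (n - k)) = u (Suc n)"
    by (subst renewal_eq[of "Suc n"]) (simp_all add: sum.atMost_Suc_shift f_0 del: sum.atMost_Suc)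
  finally show ?case using Suc by simp
qed

text \<open>A value close to the upper limit is an average of earlier values, none of which is much larger,
  so all earlier values at distances charged by \<^term>\<open>f\<close> are close to it as well.\<close>

lemma limsup_backwards:
  assumes upper: "\<And>e. 0 < e \<Longrightarrow> eventually (\<lambda>n. u n < L + e) sequentially"
    and h: "filterlim h at_top sequentially" and lim: "(\<lambda>v. u (h v)) \<longlonglongrightarrow> L" and k: "f k > 0"
  shows "(\<lambda>v. u (h v - k)) \<longlonglongrightarrow> L"
proof -
  define w where "w n = min (L - u n) 0" for n
  have w0: "w \<longlonglongrightarrow> 0"
  proof (rule LIMSEQ_I)
    fix e :: real assume "e > 0"
    from upper[OF this] obtain N where "\<forall>n\<ge>N. u n < L + e"
      by (auto simp: eventually_sequentially)
    then show "\<exists>N. \<forall>n\<ge>N. norm (w n - 0) < e"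
      using \<open>e > 0\<close> by (intro exI[of _ N]) (auto simp: w_def min_def)
  qed
  have hk: "filterlim (\<lambda>v. h v - j) at_top sequentially" for j
    by (rule filterlim_compose[OF filterlim_minus_const_nat_at_top h])
  have wB: "\<bar>w n\<bar> \<le> \<bar>L\<bar> + B" for n
    using u_bounded[of n] unfolding w_def by (auto simp: min_def)
  have conv_w: "(\<lambda>v. \<Sum>j\<le>h v. f j * w (h v - j)) \<longlonglongrightarrow> (\<Sum>j. f j) * 0"
    by (rule convolution_tendsto[OF f_summable wB h]) (rule filterlim_compose[OF w0 hk])
  have "(\<lambda>n. \<Sum>j\<le>n. f j) \<longlonglongrightarrow> 1"
    using f_sums by (simp add: sums_def_le)
  from filterlim_compose[OF this h]
  have "(\<lambda>v. L * (\<Sum>j\<le>h v. f j) - u (h v)) \<longlonglongrightarrow> L * 1 - L"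
    by (intro tendsto_diff tendsto_mult tendsto_const lim)
  from tendsto_diff[OF this conv_w]
  have conv: "(\<lambda>v. (L * (\<Sum>j\<le>h v. f j) - u (h v)) - (\<Sum>j\<le>h v. f j * w (h v - j))) \<longlonglongrightarrow> 0"
    by simp
  have "eventually (\<lambda>v. h v \<ge> Suc k) sequentially"
    using h by (simp add: filterlim_at_top)
  then have up: "eventually (\<lambda>v. f k * ((L - u (h v - k)) - w (h v - k)) \<le>
      (L * (\<Sum>j\<le>h v. f j) - u (h v)) - (\<Sum>j\<le>h v. f j * w (h v - j))) sequentially"
  proof eventually_elim
    case (elim v)
    have "(L * (\<Sum>j\<le>h v. f j) - u (h v)) - (\<Sum>j\<le>h v. f j * w (h v - j))
        = (\<Sum>j\<le>h v. f j * ((L - u (h v - j)) - w (h v - j)))"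
      using elim by (subst renewal_eq) (auto simp: sum_distrib_left sum_subtractf[symmetric] algebra_simps)
    moreover have "f k * ((L - u (h v - k)) - w (h v - k)) \<le> (\<Sum>j\<le>h v. f j * ((L - u (h v - j)) - w (h v - j)))"
      using elim by (intro member_le_sum) (auto intro!: mult_nonneg_nonneg f_nonneg simp: w_def)
    ultimately show ?case by simp
  qed
  have "(\<lambda>v. f k * ((L - u (h v - k)) - w (h v - k))) \<longlonglongrightarrow> 0"
    by (rule tendsto_sandwich[OF _ up tendsto_const conv])
       (auto intro!: always_eventually mult_nonneg_nonneg f_nonneg simp: w_def)
  then have "(\<lambda>v. inverse (f k) * (f k * ((L - u (h v - k)) - w (h v - k)))) \<longlonglongrightarrow> inverse (f k) * 0"
    by (intro tendsto_intros)
  then have "(\<lambda>v. (L - u (h v - k)) - w (h v - k)) \<longlonglongrightarrow> 0"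
    using k by simp
  from tendsto_add[OF this filterlim_compose[OF w0 hk[of k]]]
  have "(\<lambda>v. L - u (h v - k)) \<longlonglongrightarrow> 0" by simp
  from tendsto_diff[OF tendsto_const[of L] this] show ?thesis by simp
qed

lemma limsup_eq: "limsup (\<lambda>n. ereal (u n)) = ereal (u 0 / \<mu>)"
proof -
  let ?l = "limsup (\<lambda>n. ereal (u n))"
  have "?l \<le> ereal B"
    using u_bounded by (intro Limsup_bounded always_eventually) (auto simp: abs_le_iff)
  moreover have "?l \<ge> ereal (- B)"
  proof -
    have "- B \<le> u n" for n using u_bounded[of n] by (simp add: abs_le_iff)
    then have "ereal (- B) \<le> liminf (\<lambda>n. ereal (u n))"
      by (intro Liminf_bounded always_eventually) auto
    then show ?thesis using Liminf_le_Limsup[of sequentially "\<lambda>n. ereal (u n)"] by auto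
  qed
  ultimately obtain L where L: "?l = ereal L"
    by (cases ?l) auto
  have upper: "eventually (\<lambda>n. u n < L + e) sequentially" if "0 < e" for e
  proof -
    have "?l < ereal (L + e)" using L that by simp
    from Limsup_lessD[OF this] show ?thesis by simp
  qed
  obtain h where h: "strict_mono h" "((\<lambda>n. ereal (u n)) \<circ> h) \<longlonglongrightarrow> ereal L"
    using limsup_subseq_lim[of "\<lambda>n. ereal (u n)"] L by auto
  then have h_lim: "(\<lambda>v. u (h v)) \<longlonglongrightarrow> L" by (simp add: o_def)
  have h_top: "filterlim h at_top sequentially"
    using h(1) by (rule filterlim_subseq)
  define T where "T = {k. \<forall>h. filterlim h at_top sequentially \<longrightarrow> (\<lambda>v. u (h v)) \<longlonglongrightarrow> L \<longrightarrow>
    (\<lambda>v. u (h v - k)) \<longlonglongrightarrow> L}"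
  have "\<exists>K. \<forall>n\<ge>K. n \<in> T"
  proof (rule additive_closed_cofinite)
    show "0 \<in> T" by (simp add: T_def)
    show "a + b \<in> T" if ab: "a \<in> T" "b \<in> T" for a b
      unfolding T_def
    proof (intro CollectI allI impI)
      fix h assume h: "filterlim h at_top sequentially" "(\<lambda>v. u (h v)) \<longlonglongrightarrow> L"
      have "(\<lambda>v. u (h v - a)) \<longlonglongrightarrow> L"
        using ab(1) h by (auto simp: T_def)
      moreover have "filterlim (\<lambda>v. h v - a) at_top sequentially"
        by (rule filterlim_compose[OF filterlim_minus_const_nat_at_top h(1)])
      ultimately show "(\<lambda>v. u (h v - (a + b))) \<longlonglongrightarrow> L"
        using ab(2)[unfolded T_def, simplified, rule_format, of "\<lambda>v. h v - a"] by simp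
    qed
    show "\<exists>t\<in>T. \<not> d dvd t" if d: "1 < d" for d
    proof -
      obtain k where "f k > 0" "\<not> d dvd k"
        using aperiodic[OF d] by blast
      then show ?thesis
        using limsup_backwards[OF upper, of _ k] by (auto simp: T_def)
    qed
  qed
  then obtain K where K: "\<And>n. n \<ge> K \<Longrightarrow> n \<in> T" by blast
  define g where "g v = h v - K" for v
  have g_top: "filterlim g at_top sequentially"
    unfolding g_def by (rule filterlim_compose[OF filterlim_minus_const_nat_at_top h_top])
  have "(\<lambda>v. u (g v - k)) \<longlonglongrightarrow> L" for k
    using K[of "K + k"] h_top h_lim by (simp add: T_def g_def)
  moreover have "summable (\<lambda>k. \<bar>1 - (\<Sum>j\<le>k. f j)\<bar>)"
  proof -
    have "(\<Sum>j\<le>k. f j) \<le> 1" for k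
      using sum_le_suminf[of f "{..k}"] f_sums f_nonneg by (auto simp: sums_iff)
    then show ?thesis using tail_sums by (simp add: sums_iff)
  qed
  ultimately have "(\<lambda>v. \<Sum>k\<le>g v. (1 - (\<Sum>j\<le>k. f j)) * u (g v - k)) \<longlonglongrightarrow> (\<Sum>k. 1 - (\<Sum>j\<le>k. f j)) * L"
    by (intro convolution_tendsto[OF _ u_bounded g_top])
  then have "u 0 = \<mu> * L"
    using tail_sums LIMSEQ_unique[OF tendsto_const] by (fastforce simp: tail_convolution sums_iff)
  then show ?thesis using L \<mu>_pos by simp
qed

theorem renewal_theorem: "u \<longlonglongrightarrow> u 0 / \<mu>"
proof -
  interpret neg: renewal_sequence f "\<lambda>n. - u n" \<mu> B
    by standard (use f_nonneg f_0 f_sums tail_sums \<mu>_pos aperiodic u_bounded in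
      \<open>auto simp: sum_negf intro: renewal_eq\<close>)
  have "- liminf (\<lambda>n. ereal (u n)) = ereal (- (u 0 / \<mu>))"
    using neg.limsup_eq ereal_Limsup_uminus[of sequentially "\<lambda>n. ereal (u n)"] by simp
  then have "liminf (\<lambda>n. ereal (u n)) = ereal (u 0 / \<mu>)"
    by (simp add: ereal_uminus_eq_reorder)
  then have "(\<lambda>n. ereal (u n)) \<longlonglongrightarrow> ereal (u 0 / \<mu>)"
    using limsup_eq by (intro Liminf_eq_Limsup) auto
  then show ?thesis by simp
qed

end

section \<open>Averages along a renewal sequence\<close>

lemma average_tendsto_of_subsequence:
  fixes T :: "nat \<Rightarrow> nat" and A :: "nat \<Rightarrow> real"
  assumes T: "strict_mono T" "T 0 = 0" and A: "mono A" "\<And>t. A t \<ge> 0"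
    and T_lim: "(\<lambda>n. T n / n) \<longlonglongrightarrow> \<mu>" and \<mu>: "\<mu> > 0"
    and A_lim: "(\<lambda>n. A (T n) / n) \<longlonglongrightarrow> \<nu>"
  shows "(\<lambda>t. A t / t) \<longlonglongrightarrow> \<nu> / \<mu>"
proof -
  define N where "N t = Max {n. T n \<le> t}" for t
  have fin: "finite {n. T n \<le> t}" for t
    by (rule finite_subset[of _ "{..t}"]) (use strict_mono_imp_increasing[OF T(1)] in \<open>auto intro: le_trans\<close>)
  have N1: "T (N t) \<le> t" for t
  proof -
    have "0 \<in> {n. T n \<le> t}" using T(2) by simp
    then have "Max {n. T n \<le> t} \<in> {n. T n \<le> t}" by (intro Max_in fin) blast
    then show ?thesis by (simp add: N_def)
  qed
  have N2: "t < T (Suc (N t))" for t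
    using Max_ge[OF fin, of "Suc (N t)" t] by (auto simp: N_def[symmetric] not_le[symmetric])
  have N_top: "filterlim N at_top sequentially"
    unfolding filterlim_at_top
  proof
    fix Z
    show "eventually (\<lambda>t. Z \<le> N t) sequentially"
      using Max_ge[OF fin] by (auto simp: eventually_sequentially N_def)
  qed
  have SucN_top: "filterlim (\<lambda>t. Suc (N t)) at_top sequentially"
    using filterlim_compose[OF filterlim_Suc N_top] by simp
  have ratio: "(\<lambda>n. real n / real (Suc n)) \<longlonglongrightarrow> 1"
    by (rule LIMSEQ_n_over_Suc_n)
  have ratio': "(\<lambda>n. real (Suc n) / real n) \<longlonglongrightarrow> 1"
    by (rule LIMSEQ_Suc_n_over_n)
  have lower: "(\<lambda>n. (A (T n) / n) * (real n / real (Suc n)) / (T (Suc n) / Suc n)) \<longlonglongrightarrow> \<nu> * 1 / \<mu>"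
    using \<mu> by (intro tendsto_intros A_lim ratio LIMSEQ_Suc[OF T_lim]) auto
  have upper: "(\<lambda>n. (A (T (Suc n)) / Suc n) * (real (Suc n) / real n) / (T n / n)) \<longlonglongrightarrow> \<nu> * 1 / \<mu>"
    using \<mu> by (intro tendsto_intros LIMSEQ_Suc[OF A_lim] ratio' T_lim) auto
  have ev: "eventually (\<lambda>t. 1 \<le> N t) sequentially"
    using N_top by (simp add: filterlim_at_top)
  have pos: "T n > 0" if "n \<ge> 1" for n
    using strict_mono_less[OF T(1), of 0 n] that T(2) by simp
  show ?thesis
  proof (rule tendsto_sandwich)
    show "eventually (\<lambda>t. (A (T (N t)) / N t) * (real (N t) / real (Suc (N t))) / (T (Suc (N t)) / Suc (N t)) \<le> A t / t) sequentially"
      using ev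
    proof eventually_elim
      case (elim t)
      have "A (T (N t)) / T (Suc (N t)) \<le> A t / t"
        using N1[of t] N2[of t] pos[OF elim] A by (intro frac_le) (auto dest: monoD)
      then show ?case using elim by simp
    qed
    show "eventually (\<lambda>t. A t / t \<le> (A (T (Suc (N t))) / Suc (N t)) * (real (Suc (N t)) / real (N t)) / (T (N t) / N t)) sequentially"
      using ev
    proof eventually_elim
      case (elim t)
      have "A t / t \<le> A (T (Suc (N t))) / T (N t)"
        using N1[of t] N2[of t] pos[OF elim] A by (intro frac_le) (auto intro: monoD)
      then show ?case using elim by simp
    qed
    show "(\<lambda>t. (A (T (N t)) / N t) * (real (N t) / real (Suc (N t))) / (T (Suc (N t)) / Suc (N t))) \<longlonglongrightarrow> \<nu> / \<mu>"
      using filterlim_compose[OF lower N_top] by simp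
    show "(\<lambda>t. (A (T (Suc (N t))) / Suc (N t)) * (real (Suc (N t)) / real (N t)) / (T (N t) / N t)) \<longlonglongrightarrow> \<nu> / \<mu>"
      using filterlim_compose[OF upper N_top] by simp
  qed
qed

section \<open>The strong law of large numbers\<close>

fun running_max :: "nat \<Rightarrow> (nat \<Rightarrow> real) \<Rightarrow> real" where
  "running_max 0 z = 0"
| "running_max (Suc n) z = max 0 (z 0 + running_max n (\<lambda>i. z (Suc i)))"

lemma running_max_nonneg: "running_max n z \<ge> 0"
  by (cases n) auto

lemma running_max_le: "running_max n z \<le> (\<Sum>i<n. \<bar>z i\<bar>)"
proof (induction n arbitrary: z)
  case (Suc n)
  show ?case
    using Suc[of "\<lambda>i. z (Suc i)"] by (auto simp: sum.lessThan_Suc_shift sum_nonneg simp del: sum.lessThan_Suc)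
qed simp

lemma partial_sum_le_running_max: "k \<le> n \<Longrightarrow> (\<Sum>i<k. z i) \<le> running_max n z"
proof (induction n arbitrary: z k)
  case (Suc n)
  show ?case
  proof (cases k)
    case (Suc k')
    then show ?thesis
      using Suc.IH[of k' "\<lambda>i. z (Suc i)"] Suc.prems
      by (auto simp: sum.lessThan_Suc_shift simp del: sum.lessThan_Suc)
  qed (simp add: running_max_nonneg)
qed simp

lemma running_max_mono: "running_max n z \<le> running_max (Suc n) z"
proof (induction n arbitrary: z)
  case (Suc n)
  then show ?case using Suc[of "\<lambda>i. z (Suc i)"] by simp
qed simp

lemma running_max_measurable [measurable]:
  "running_max n \<in> borel_measurable (\<Pi>\<^sub>M i\<in>UNIV. borel)"
proof (induction n)
  case (Suc n)
  note [measurable] = Suc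
  have [measurable]: "(\<lambda>z i. z (Suc i)) \<in> measurable (\<Pi>\<^sub>M i\<in>UNIV. borel) (\<Pi>\<^sub>M i\<in>UNIV. (borel :: real measure))"
    by (intro measurable_PiM_single') auto
  show ?case by simp measurable
qed simp

lemma unbounded_iff_partial_sums_from:
  fixes z :: "nat \<Rightarrow> real"
  shows "(\<forall>k::nat. \<exists>m. (\<Sum>i<m. z i) > real k) \<longleftrightarrow> (\<forall>k::nat. \<exists>m\<ge>n. (\<Sum>i=n..<m. z i) > real k)"
proof -
  define A where "A = (\<Sum>i<n. \<bar>z i\<bar>)"
  have A: "A \<ge> 0" by (simp add: A_def sum_nonneg)
  have head: "\<bar>\<Sum>i<m. z i\<bar> \<le> A" if "m \<le> n" for m
  proof -
    have "\<bar>\<Sum>i<m. z i\<bar> \<le> (\<Sum>i<m. \<bar>z i\<bar>)" by (rule sum_abs)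
    also have "\<dots> \<le> A" unfolding A_def using that by (intro sum_mono2) auto
    finally show ?thesis .
  qed
  have split: "(\<Sum>i<m. z i) = (\<Sum>i<n. z i) + (\<Sum>i=n..<m. z i)" if "n \<le> m" for m
    using that by (metis atLeast0LessThan le0 sum.atLeastLessThan_concat)
  show ?thesis
  proof safe
    fix k :: nat assume *: "\<forall>k::nat. \<exists>m. (\<Sum>i<m. z i) > real k"
    then obtain m where m: "(\<Sum>i<m. z i) > real (k + nat \<lceil>A\<rceil>)" by blast
    then have m': "(\<Sum>i<m. z i) > real k + A" using A by (auto simp: le_of_int_ceiling less_le_trans)
         (smt (verit) le_of_int_ceiling of_nat_nat zero_le_ceiling)
    then have "n \<le> m" using head[of m] by (cases "n \<le> m") auto
    with m' head[of n] split[of m] show "\<exists>m\<ge>n. (\<Sum>i=n..<m. z i) > real k"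
      by (intro exI[of _ m]) auto
  next
    fix k :: nat assume *: "\<forall>k::nat. \<exists>m\<ge>n. (\<Sum>i=n..<m. z i) > real k"
    then obtain m where m: "n \<le> m" "(\<Sum>i=n..<m. z i) > real (k + nat \<lceil>A\<rceil>)" by blast
    then have "(\<Sum>i=n..<m. z i) > real k + A"
      by (smt (verit) real_nat_ceiling_ge of_nat_add)
    with m head[of n] split[of m] show "\<exists>m. (\<Sum>i<m. z i) > real k"
      by (intro exI[of _ m]) auto
  qed
qed

context prob_space
begin

lemma indep_vars_reindex:
  assumes inj: "inj_on g I" and indep: "indep_vars N Y (g ` I)"
  shows "indep_vars (\<lambda>i. N (g i)) (\<lambda>i. Y (g i)) I"
proof -
  define A where "A i = {Y i -` B \<inter> space M | B. B \<in> sets (N i)}" for i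
  have *: "indep_sets A (g ` I)" and rv: "\<And>i. i \<in> g ` I \<Longrightarrow> random_variable (N i) (Y i)"
    using indep unfolding A_def[abs_def] indep_vars_def2 by blast+
  have "indep_sets (\<lambda>i. A (g i)) I"
  proof (rule indep_setsI)
    show "A (g i) \<subseteq> events" if "i \<in> I" for i
      using * that by (auto simp: indep_sets_def)
    fix E J assume J: "J \<noteq> {}" "J \<subseteq> I" "finite J" and E: "\<forall>j\<in>J. E j \<in> A (g j)"
    have injJ: "inj_on g J" using inj_on_subset[OF inj J(2)] .
    define E' where "E' j = E (the_inv_into J g j)" for j
    have E': "E' (g j) = E j" if "j \<in> J" for j
      using that by (simp add: E'_def the_inv_into_f_f[OF injJ])
    have "prob (\<Inter>j\<in>g ` J. E' j) = (\<Prod>j\<in>g ` J. prob (E' j))"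
      using J E E' by (intro indep_setsD[OF *]) auto
    also have "(\<Inter>j\<in>g ` J. E' j) = (\<Inter>j\<in>J. E j)" using E' by auto
    also have "(\<Prod>j\<in>g ` J. prob (E' j)) = (\<Prod>j\<in>J. prob (E j))"
      using E' by (subst prod.reindex[OF injJ]) (auto intro!: prod.cong)
    finally show "prob (\<Inter>j\<in>J. E j) = (\<Prod>j\<in>J. prob (E j))" .
  qed
  then show ?thesis using rv by (auto simp: indep_vars_def2 A_def)
qed

lemma partial_sums_unbounded_0_1:
  fixes Z :: "nat \<Rightarrow> 'a \<Rightarrow> real"
  assumes indep: "indep_vars (\<lambda>_. borel) Z UNIV"
  shows "prob {\<omega> \<in> space M. \<forall>k::nat. \<exists>m. (\<Sum>i<m. Z i \<omega>) > real k} \<in> {0, 1}"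
proof -
  define A where "A i = sigma_sets (space M) {Z i -` B \<inter> space M | B. B \<in> sets borel}" for i
  have sub: "{Z i -` B \<inter> space M | B. B \<in> sets borel} \<subseteq> Pow (space M)" for i
    by auto
  have "prob {\<omega> \<in> space M. \<forall>k::nat. \<exists>m. (\<Sum>i<m. Z i \<omega>) > real k} = 0 \<or>
        prob {\<omega> \<in> space M. \<forall>k::nat. \<exists>m. (\<Sum>i<m. Z i \<omega>) > real k} = 1"
  proof (rule kolmogorov_0_1_law)
    show "sigma_algebra (space M) (A i)" for i
      unfolding A_def by (rule sigma_algebra_sigma_sets[OF sub])
    show "indep_sets A UNIV"
      using indep unfolding indep_vars_def A_def by auto
    show "{\<omega> \<in> space M. \<forall>k::nat. \<exists>m. (\<Sum>i<m. Z i \<omega>) > real k} \<in> tail_events A"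
      unfolding tail_events_def
    proof
      fix n
      define N where "N = sigma (space M) (\<Union> (A ` {n..}))"
      have A_sub: "\<Union> (A ` {n..}) \<subseteq> Pow (space M)"
        unfolding A_def using sigma_sets_into_sp[OF sub] by blast
      have sets_N: "sets N = sigma_sets (space M) (\<Union> (A ` {n..}))" and space_N: "space N = space M"
        using A_sub by (simp_all add: N_def)
      have [measurable]: "Z i \<in> borel_measurable N" if "i \<ge> n" for i
      proof (rule measurableI)
        fix B :: "real set" assume "B \<in> sets borel"
        then have "Z i -` B \<inter> space M \<in> A i" unfolding A_def by (auto intro!: sigma_sets.Basic)
        then show "Z i -` B \<inter> space N \<in> sets N"
          unfolding space_N sets_N using that by (auto intro!: sigma_sets.Basic)
      qed simp
      have "{\<omega> \<in> space M. \<forall>k::nat. \<exists>m. (\<Sum>i<m. Z i \<omega>) > real k}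
          = {\<omega> \<in> space N. \<forall>k::nat. \<exists>m\<in>{n..}. (\<Sum>i=n..<m. Z i \<omega>) > real k}"
        unfolding space_N unbounded_iff_partial_sums_from[where n = n] by auto
      also have "\<dots> \<in> sets N" by measurable
      finally show "{\<omega> \<in> space M. \<forall>k::nat. \<exists>m. (\<Sum>i<m. Z i \<omega>) > real k} \<in> sigma_sets (space M) (\<Union> (A ` {n..}))"
        by (simp add: sets_N)
    qed
  qed
  then show ?thesis by simp
qed

lemma iid_shift_distr:
  fixes Z :: "nat \<Rightarrow> 'a \<Rightarrow> real"
  assumes indep: "indep_vars (\<lambda>_. borel) Z UNIV"
    and ident: "\<And>n. distr M borel (Z n) = distr M borel (Z 0)"
  shows "distr M (\<Pi>\<^sub>M i\<in>UNIV. borel) (\<lambda>\<omega> i. Z (Suc i) \<omega>) = distr M (\<Pi>\<^sub>M i\<in>UNIV. borel) (\<lambda>\<omega> i. Z i \<omega>)"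
proof -
  have Z: "random_variable borel (Z i)" for i
    using indep by (auto simp: indep_vars_def)
  have indep': "indep_vars (\<lambda>_. borel) (\<lambda>i. Z (Suc i)) UNIV"
    using indep_vars_subset[OF indep, of "range Suc"]
    by (intro indep_vars_reindex[of Suc UNIV "\<lambda>_. borel" Z]) auto
  have "distr M (\<Pi>\<^sub>M i\<in>UNIV. borel) (\<lambda>\<omega>. \<lambda>i\<in>UNIV. Z (Suc i) \<omega>) = (\<Pi>\<^sub>M i\<in>UNIV. distr M borel (Z (Suc i)))"
    using indep' Z by (subst (asm) indep_vars_iff_distr_eq_PiM) auto
  also have "\<dots> = (\<Pi>\<^sub>M i\<in>UNIV. distr M borel (Z i))"
    by (rule PiM_cong) (use ident in metis)+
  also have "\<dots> = distr M (\<Pi>\<^sub>M i\<in>UNIV. borel) (\<lambda>\<omega>. \<lambda>i\<in>UNIV. Z i \<omega>)"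
    using indep Z by (subst (asm) indep_vars_iff_distr_eq_PiM) auto
  finally show ?thesis by (simp add: restrict_def)
qed

text \<open>The maximum of the first \<^term>\<open>n\<close> partial sums equals in law the same maximum for the shifted
  sequence, so the expectation of \<^term>\<open>max (- running_max n (\<lambda>i. Z (Suc i) \<omega>)) (Z 0 \<omega>)\<close> is nonnegative. If the
  partial sums were unbounded, it would tend to the expectation of \<^term>\<open>Z 0\<close>.\<close>

lemma partial_sums_bounded_above:
  fixes Z :: "nat \<Rightarrow> 'a \<Rightarrow> real"
  assumes indep: "indep_vars (\<lambda>_. borel) Z UNIV"
    and ident: "\<And>n. distr M borel (Z n) = distr M borel (Z 0)"
    and int: "integrable M (Z 0)" and neg: "expectation (Z 0) < 0"
  shows "AE \<omega> in M. \<exists>k::nat. \<forall>m. (\<Sum>i<m. Z i \<omega>) \<le> real k"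
proof -
  have Z[measurable]: "Z i \<in> borel_measurable M" for i
    using indep by (auto simp: indep_vars_def)
  have int: "integrable M (Z i)" for i
  proof -
    have "integrable (distr M borel (Z 0)) (\<lambda>x. x)"
      using int by (subst integrable_distr_eq) auto
    then have "integrable (distr M borel (Z i)) (\<lambda>x. x)"
      by (simp only: ident[of i])
    then show ?thesis by (subst (asm) integrable_distr_eq) auto
  qed
  let ?U = "{\<omega> \<in> space M. \<forall>k::nat. \<exists>m. (\<Sum>i<m. Z i \<omega>) > real k}"
  let ?R = "\<lambda>n \<omega>. running_max n (\<lambda>i. Z i \<omega>)"
  let ?R' = "\<lambda>n \<omega>. running_max n (\<lambda>i. Z (Suc i) \<omega>)"
  have vec[measurable]: "(\<lambda>\<omega> i. Z i \<omega>) \<in> measurable M (\<Pi>\<^sub>M i\<in>UNIV. borel)"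
      "(\<lambda>\<omega> i. Z (Suc i) \<omega>) \<in> measurable M (\<Pi>\<^sub>M i\<in>UNIV. borel)"
    by (intro measurable_PiM_single'; simp)+
  have R_int: "integrable M (?R n)" "integrable M (?R' n)" for n
  proof -
    show "integrable M (?R n)"
      by (rule Bochner_Integration.integrable_bound[of M "\<lambda>\<omega>. \<Sum>i<n. \<bar>Z i \<omega>\<bar>"])
         (auto intro!: int AE_I2 simp: running_max_nonneg running_max_le sum_nonneg)
    show "integrable M (?R' n)"
      by (rule Bochner_Integration.integrable_bound[of M "\<lambda>\<omega>. \<Sum>i<n. \<bar>Z (Suc i) \<omega>\<bar>"])
         (auto intro!: int AE_I2 simp: running_max_nonneg running_max_le sum_nonneg)
  qed
  have eq: "expectation (?R' n) = expectation (?R n)" for n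
    using integral_distr[OF vec(1) running_max_measurable[of n]]
      integral_distr[OF vec(2) running_max_measurable[of n]] iid_shift_distr[OF indep ident] by simp
  have "0 \<le> expectation (\<lambda>\<omega>. max (- ?R' n \<omega>) (Z 0 \<omega>))" for n
  proof -
    have "0 \<le> expectation (?R (Suc n)) - expectation (?R n)"
      using integral_mono[OF R_int(1)[of n] R_int(1)[of "Suc n"]] running_max_mono by (simp del: running_max.simps)
    also have "\<dots> = expectation (?R (Suc n)) - expectation (?R' n)"
      by (simp add: eq)
    also have "\<dots> = expectation (\<lambda>\<omega>. ?R (Suc n) \<omega> - ?R' n \<omega>)"
      by (rule Bochner_Integration.integral_diff[symmetric]) (rule R_int)+
    also have "(\<lambda>\<omega>. ?R (Suc n) \<omega> - ?R' n \<omega>) = (\<lambda>\<omega>. max (- ?R' n \<omega>) (Z 0 \<omega>))"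
      by (auto simp: max_def fun_eq_iff)
    finally show ?thesis .
  qed
  note nonneg = this
  have "prob ?U \<noteq> 1"
  proof
    assume "prob ?U = 1"
    then have AE_U: "AE \<omega> in M. \<forall>k::nat. \<exists>m. (\<Sum>i<m. Z i \<omega>) > real k"
      by (subst (asm) prob_Collect_eq_1) auto
    have "(\<lambda>n. expectation (\<lambda>\<omega>. max (- ?R' n \<omega>) (Z 0 \<omega>))) \<longlonglongrightarrow> expectation (Z 0)"
    proof (rule integral_dominated_convergence[where w = "\<lambda>\<omega>. \<bar>Z 0 \<omega>\<bar>"])
      show "AE \<omega> in M. (\<lambda>n. max (- ?R' n \<omega>) (Z 0 \<omega>)) \<longlonglongrightarrow> Z 0 \<omega>"
        using AE_U
      proof eventually_elim
        case (elim \<omega>)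
        then obtain m where m: "m \<ge> 1" "(\<Sum>i=1..<m. Z i \<omega>) > real (nat \<lceil>\<bar>Z 0 \<omega>\<bar>\<rceil>)"
          unfolding unbounded_iff_partial_sums_from[where n = 1] by blast
        then obtain m' where m': "m = Suc m'" by (cases m) auto
        have "(\<Sum>i<m'. Z (Suc i) \<omega>) = (\<Sum>i=1..<m. Z i \<omega>)"
          using sum.shift_bounds_Suc_ivl[of "\<lambda>i. Z i \<omega>" 0 m'] by (simp add: m' atLeast0LessThan)
        then have "(\<Sum>i<m'. Z (Suc i) \<omega>) \<ge> \<bar>Z 0 \<omega>\<bar>"
          using m(2) by linarith
        then have "?R' n \<omega> \<ge> \<bar>Z 0 \<omega>\<bar>" if "n \<ge> m'" for n
          using partial_sum_le_running_max[OF that, of "\<lambda>i. Z (Suc i) \<omega>"] by linarith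
        then have "eventually (\<lambda>n. max (- ?R' n \<omega>) (Z 0 \<omega>) = Z 0 \<omega>) sequentially"
          by (intro eventually_sequentiallyI[of m']) (force simp: max_def)
        then show ?case by (rule tendsto_eventually)
      qed
      show "AE \<omega> in M. norm (max (- ?R' n \<omega>) (Z 0 \<omega>)) \<le> \<bar>Z 0 \<omega>\<bar>" for n
      proof (rule AE_I2)
        show "norm (max (- ?R' n \<omega>) (Z 0 \<omega>)) \<le> \<bar>Z 0 \<omega>\<bar>" for \<omega>
          using running_max_nonneg[of n "\<lambda>i. Z (Suc i) \<omega>"] by (auto simp: max_def)
      qed
    qed (use int in auto)
    from LIMSEQ_le_const[OF this, of 0] nonneg neg show False by auto
  qed
  then have "prob ?U = 0"
    using partial_sums_unbounded_0_1[OF indep] by simp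
  then have "AE \<omega> in M. \<not> (\<forall>k::nat. \<exists>m. (\<Sum>i<m. Z i \<omega>) > real k)"
    by (subst (asm) prob_Collect_eq_0) auto
  then show ?thesis by (simp add: not_less)
qed

lemma slln_upper:
  fixes Z :: "nat \<Rightarrow> 'a \<Rightarrow> real"
  assumes indep: "indep_vars (\<lambda>_. borel) Z UNIV"
    and ident: "\<And>n. distr M borel (Z n) = distr M borel (Z 0)"
    and int: "integrable M (Z 0)" and e: "0 < e"
  shows "AE \<omega> in M. eventually (\<lambda>n. (\<Sum>i<n. Z i \<omega>) / n < expectation (Z 0) + e) sequentially"
proof -
  define a where "a = expectation (Z 0) + e / 2"
  have Z[measurable]: "Z i \<in> borel_measurable M" for i
    using indep by (auto simp: indep_vars_def)
  have "AE \<omega> in M. \<exists>k::nat. \<forall>m. (\<Sum>i<m. Z i \<omega> - a) \<le> real k"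
  proof (rule partial_sums_bounded_above)
    show "indep_vars (\<lambda>_. borel) (\<lambda>i \<omega>. Z i \<omega> - a) UNIV"
      by (rule indep_vars_compose2[OF indep, of "\<lambda>_ x. x - a"]) auto
    have "distr M borel (\<lambda>\<omega>. Z n \<omega> - a) = distr (distr M borel (Z n)) borel (\<lambda>x. x - a)" for n
      by (simp add: distr_distr o_def)
    then show "distr M borel (\<lambda>\<omega>. Z n \<omega> - a) = distr M borel (\<lambda>\<omega>. Z 0 \<omega> - a)" for n
      using ident[of n] by simp
    show "integrable M (\<lambda>\<omega>. Z 0 \<omega> - a)" using int by simp
    show "expectation (\<lambda>\<omega>. Z 0 \<omega> - a) < 0"
      using int e by (simp add: a_def prob_space)
  qed
  then show ?thesis
  proof eventually_elim
    case (elim \<omega>)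
    then obtain k :: nat where k: "\<And>m. (\<Sum>i<m. Z i \<omega>) - m * a \<le> real k"
      by (auto simp: sum_subtractf)
    have "(\<lambda>n. real k / real n) \<longlonglongrightarrow> 0" by (rule lim_const_over_n)
    then have "eventually (\<lambda>n. real k / real n < e / 2) sequentially"
      using e by (intro order_tendstoD) auto
    then show ?case
      using eventually_gt_at_top[of 0]
    proof eventually_elim
      case (elim n)
      have "(\<Sum>i<n. Z i \<omega>) / n \<le> (real k + n * a) / n"
        using k[of n] elim by (intro divide_right_mono) auto
      also have "\<dots> = real k / n + a" using elim by (simp add: field_simps)
      also have "\<dots> < expectation (Z 0) + e" using elim unfolding a_def by linarith
      finally show ?case .
    qed
  qed
qed

theorem strong_law_of_large_numbers:
  fixes Z :: "nat \<Rightarrow> 'a \<Rightarrow> real"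
  assumes indep: "indep_vars (\<lambda>_. borel) Z UNIV"
    and ident: "\<And>n. distr M borel (Z n) = distr M borel (Z 0)"
    and int: "integrable M (Z 0)"
  shows "AE \<omega> in M. (\<lambda>n. (\<Sum>i<n. Z i \<omega>) / n) \<longlonglongrightarrow> expectation (Z 0)"
proof -
  have Z[measurable]: "Z i \<in> borel_measurable M" for i
    using indep by (auto simp: indep_vars_def)
  have "AE \<omega> in M. \<forall>j::nat. eventually (\<lambda>n. (\<Sum>i<n. Z i \<omega>) / n < expectation (Z 0) + 1 / Suc j) sequentially"
    unfolding AE_all_countable by (intro allI slln_upper assms) auto
  moreover have "AE \<omega> in M. \<forall>j::nat. eventually (\<lambda>n. (\<Sum>i<n. - Z i \<omega>) / n < expectation (\<lambda>\<omega>. - Z 0 \<omega>) + 1 / Suc j) sequentially"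
    unfolding AE_all_countable
  proof (intro allI slln_upper)
    show "indep_vars (\<lambda>_. borel) (\<lambda>i \<omega>. - Z i \<omega>) UNIV"
      by (rule indep_vars_compose2[OF indep, of "\<lambda>_ x. - x"]) auto
    have "distr M borel (\<lambda>\<omega>. - Z n \<omega>) = distr (distr M borel (Z n)) borel (\<lambda>x. - x)" for n
      by (simp add: distr_distr o_def)
    then show "distr M borel (\<lambda>\<omega>. - Z n \<omega>) = distr M borel (\<lambda>\<omega>. - Z 0 \<omega>)" for n
      using ident[of n] by simp
  qed (use int in auto)
  ultimately show ?thesis
  proof eventually_elim
    case (elim \<omega>)
    show ?case
    proof (rule LIMSEQ_I)
      fix e :: real assume "e > 0"
      then obtain j where j: "1 / real (Suc j) < e"
        using nat_approx_posE by blast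
      have "eventually (\<lambda>n. norm ((\<Sum>i<n. Z i \<omega>) / n - expectation (Z 0)) < e) sequentially"
        using elim(1)[rule_format, of j] elim(2)[rule_format, of j]
        by eventually_elim (use j in \<open>simp add: sum_negf abs_less_iff\<close>)
      then show "\<exists>N. \<forall>n\<ge>N. norm ((\<Sum>i<n. Z i \<omega>) / n - expectation (Z 0)) < e"
        by (simp add: eventually_sequentially)
    qed
  qed
qed

end

section \<open>Return times\<close>

lemma tau_Suc_eq_enat_iff:
  "tau X (Suc n) \<omega> = enat t \<longleftrightarrow>
     (\<exists>k<t. tau X n \<omega> = enat k \<and> X t \<omega> = 0 \<and> (\<forall>s. k < s \<longrightarrow> s < t \<longrightarrow> X s \<omega> \<noteq> 0))"
proof (cases "tau X n \<omega>")
  case (enat k)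
  show ?thesis
  proof (cases "\<exists>t>k. X t \<omega> = 0")
    case True
    define l where "l = (LEAST t. k < t \<and> X t \<omega> = 0)"
    have l: "k < l" "X l \<omega> = 0"
      unfolding l_def using LeastI_ex[OF True] by auto
    have least: "X s \<omega> \<noteq> 0" if "k < s" "s < l" for s
      using that not_less_Least[of s "\<lambda>t. k < t \<and> X t \<omega> = 0"] by (auto simp: l_def)
    have "tau X (Suc n) \<omega> = enat l"
      using True enat by (simp add: l_def)
    then show ?thesis
      using l least enat by (auto intro: linorder_cases[of t l])
  next
    case False
    then show ?thesis using enat by auto
  qed
qed simp

lemma tau_ge_1: "tau X n \<omega> \<ge> 1"
proof (cases "tau X n \<omega>")
  case (enat k)
  then have "k \<ge> 1"
  proof (induction n arbitrary: k)
    case (Suc n)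
    then show ?case unfolding tau_Suc_eq_enat_iff by fastforce
  qed (simp add: one_enat_def)
  then show ?thesis using enat by (simp add: one_enat_def)
qed simp

lemma tau_1_gt_iff:
  assumes "t \<ge> 1"
  shows "enat t < tau X 1 \<omega> \<longleftrightarrow> (\<forall>s\<in>{2..t}. X s \<omega> \<noteq> 0)"
proof (cases "tau X 1 \<omega>")
  case (enat l)
  then have l: "1 < l" "X l \<omega> = 0" "\<And>s. 1 < s \<Longrightarrow> s < l \<Longrightarrow> X s \<omega> \<noteq> 0"
    using tau_Suc_eq_enat_iff[of X 0 \<omega> l] by (auto simp: one_enat_def)
  then show ?thesis using enat by (auto simp: not_le[symmetric])
next
  case infinity
  then have "\<not> (\<exists>t>1. X t \<omega> = 0)"
    by (auto simp: one_enat_def split: if_splits)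
  then show ?thesis using infinity by auto
qed

lemma tau_measurable:
  assumes X[measurable]: "\<And>t. t \<ge> 1 \<Longrightarrow> X t \<in> borel_measurable M"
  shows "tau X n \<in> measurable M (count_space UNIV)"
proof -
  have fin: "{\<omega> \<in> space M. tau X n \<omega> = enat t} \<in> sets M" for t
  proof (induction n arbitrary: t)
    case (Suc n)
    have meas: "{\<omega> \<in> space M. X s \<omega> = 0} \<in> sets M" if "s \<ge> 1" for s
      using X[OF that] by measurable
    have "{\<omega> \<in> space M. tau X (Suc n) \<omega> = enat t} =
       (\<Union>k\<in>{1..<t}. {\<omega> \<in> space M. tau X n \<omega> = enat k} \<inter> {\<omega> \<in> space M. X t \<omega> = 0}
          - (\<Union>s\<in>{k<..<t}. {\<omega> \<in> space M. X s \<omega> = 0}))"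
    proof -
      have "k \<ge> 1" if "tau X n \<omega> = enat k" for k \<omega>
        using tau_ge_1[of X n \<omega>] that by (simp add: one_enat_def)
      then show ?thesis
        unfolding tau_Suc_eq_enat_iff by (fastforce simp: Bex_def)
    qed
    also have "\<dots> \<in> sets M"
      using Suc meas by (intro sets.finite_UN sets.Diff sets.Int) auto
    finally show ?case .
  qed auto
  have all: "{\<omega> \<in> space M. tau X n \<omega> = a} \<in> sets M" for a
  proof (cases a)
    case infinity
    have "{\<omega> \<in> space M. tau X n \<omega> = \<infinity>} = space M - (\<Union>t. {\<omega> \<in> space M. tau X n \<omega> = enat t})"
      by auto
    then show ?thesis using infinity fin by auto
  qed (use fin in auto)
  show ?thesis
    unfolding measurable_count_space_eq2_countable
    using all by (auto simp: vimage_def Int_def conj_commute)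
qed

lemma eta_1_eq: "eta X 1 \<omega> = tau X 1 \<omega> - 1"
  by (simp add: eta_def)

lemma less_eta_1_iff: "enat t < eta X 1 \<omega> \<longleftrightarrow> (\<forall>s\<in>{2..Suc t}. X s \<omega> \<noteq> 0)"
  using tau_1_gt_iff[of "Suc t" X \<omega>]
  unfolding eta_1_eq by (cases "tau X 1 \<omega>") (auto simp: one_enat_def)

section \<open>Integrability of the first return time\<close>

lemma sum_shift_diff_le:
  fixes g :: "nat \<Rightarrow> real"
  assumes "\<And>t. 0 \<le> g t" "\<And>t. g t \<le> 1"
  shows "(\<Sum>t<n. g t - g (t + k)) \<le> k"
proof (induction k)
  case (Suc k)
  have "(\<Sum>t<n. g t - g (t + Suc k)) = (\<Sum>t<n. g t - g (t + k)) + (\<Sum>t<n. g (t + k) - g (Suc t + k))"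
    by (simp add: sum.distrib[symmetric])
  also have "(\<Sum>t<n. g (t + k) - g (Suc t + k)) = g k - g (n + k)"
    using sum_lessThan_telescope'[of "\<lambda>t. g (t + k)" n] by simp
  finally show ?case using Suc assms(2)[of k] assms(1)[of "n + k"] by simp
qed simp

locale lamperti_process = prob_space M for M :: "'a measure" +
  fixes F :: "nat \<Rightarrow> 'a measure" and X :: "nat \<Rightarrow> 'a \<Rightarrow> real" and S :: "real set" and c s2 p :: real
  assumes S_nonneg: "S \<subseteq> {0..}"
    and S_locfin: "\<And>b. finite (S \<inter> {..b})"
    and S_zero: "0 \<in> S"
    and filt_sub: "\<And>t. 1 \<le> t \<Longrightarrow> subalgebra M (F t)"
    and filt_mono: "\<And>s t. 1 \<le> s \<Longrightarrow> s \<le> t \<Longrightarrow> sets (F s) \<subseteq> sets (F t)"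
    and adapted: "\<And>t. 1 \<le> t \<Longrightarrow> X t \<in> borel_measurable (F t)"
    and S_valued: "\<And>t \<omega>. 1 \<le> t \<Longrightarrow> \<omega> \<in> space M \<Longrightarrow> X t \<omega> \<in> S"
    and start: "measure M {\<omega> \<in> space M. X 1 \<omega> = 0} = 1"
    and A1: "\<exists>(m :: real \<Rightarrow> real \<Rightarrow> nat) (\<phi> :: real \<Rightarrow> real \<Rightarrow> real).
              (\<forall>x\<in>S. \<forall>y\<in>S. 1 \<le> m x y \<and> 0 < \<phi> x y) \<and>
              (\<forall>y\<in>S. \<forall>t\<ge>1. AE \<omega> in M.
                 real_cond_exp M (F t)
                   (indicator {\<omega>' \<in> space M. X (t + m (X t \<omega>') y) \<omega>' = y}) \<omega>
                 \<ge> \<phi> (X t \<omega>) y)"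
    and s2_pos: "0 < s2"
    and Delta_L2: "\<And>t. 1 \<le> t \<Longrightarrow> integrable M (\<lambda>\<omega>. (X (t + 1) \<omega> - X t \<omega>)\<^sup>2)"
    and A2_mean: "\<And>\<epsilon>. 0 < \<epsilon> \<Longrightarrow> \<exists>x0. \<forall>t\<ge>1. AE \<omega> in M. X t \<omega> \<ge> x0 \<longrightarrow>
              \<bar>real_cond_exp M (F t) (\<lambda>\<omega>'. X (t + 1) \<omega>' - X t \<omega>') \<omega> - c / X t \<omega>\<bar>
                \<le> \<epsilon> / (X t \<omega> * ln (X t \<omega>))"
    and A2_var: "\<And>\<epsilon>. 0 < \<epsilon> \<Longrightarrow> \<exists>x0. \<forall>t\<ge>1. AE \<omega> in M. X t \<omega> \<ge> x0 \<longrightarrow>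
              \<bar>real_cond_exp M (F t) (\<lambda>\<omega>'. (X (t + 1) \<omega>' - X t \<omega>')\<^sup>2) \<omega> - s2\<bar>
                \<le> \<epsilon> / ln (X t \<omega>)"
    and r_gt: "- 2 * c / s2 > 1"
    and p_gt: "p > 1 + (- 2 * c / s2)"
    and Mp: "\<exists>\<delta>>0. \<exists>C::real. \<forall>t\<ge>1. AE \<omega> in M.
              nn_cond_exp M (F t) (\<lambda>\<omega>'. ennreal (\<bar>X (t + 1) \<omega>' - X t \<omega>'\<bar> powr p)) \<omega>
                \<le> ennreal (C * (1 + X t \<omega>) powr (p - 2 - \<delta>))"
begin

lemma X_measurable [measurable (raw)]: "1 \<le> t \<Longrightarrow> X t \<in> borel_measurable M"
  using measurable_from_subalg[OF filt_sub adapted] by blast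

lemma X_measurable_F: "1 \<le> s \<Longrightarrow> s \<le> t \<Longrightarrow> X s \<in> borel_measurable (F t)"
  using adapted[of s] filt_mono[of s t] filt_sub[of s] filt_sub[of t]
  by (auto simp: measurable_def subalgebra_def)

lemma X_nonneg: "1 \<le> t \<Longrightarrow> \<omega> \<in> space M \<Longrightarrow> X t \<omega> \<ge> 0"
  using S_valued S_nonneg by force

lemma space_F: "1 \<le> t \<Longrightarrow> space (F t) = space M"
  using filt_sub by (simp add: subalgebra_def)

lemma sigma_finite_subalgebra_F: "1 \<le> t \<Longrightarrow> sigma_finite_subalgebra M (F t)"
  using filt_sub by (intro finite_measure_subalgebra_is_sigma_finite) (auto simp: finite_measure_subalgebra_def finite_measure_subalgebra_axioms_def finite_measure_axioms)

lemma countable_S: "countable S"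
proof -
  have "S = (\<Union>n::nat. S \<inter> {..real n})"
    using real_arch_simple by auto
  then show ?thesis
    by (metis S_locfin countable_UN countable_finite countableI_type)
qed

lemma start_AE: "AE \<omega> in M. X 1 \<omega> = 0"
  using start by (subst (asm) prob_Collect_eq_1) auto

definition before_return :: "nat \<Rightarrow> 'a set" where
  "before_return t = {\<omega> \<in> space M. \<forall>s\<in>{2..t}. X s \<omega> \<noteq> 0}"

lemma before_return_F:
  assumes "1 \<le> t" shows "before_return t \<in> sets (F t)"
proof -
  have "{\<omega> \<in> space (F t). \<forall>s\<in>{2..t}. X s \<omega> \<noteq> 0} \<in> sets (F t)"
    using X_measurable_F by (intro sets.sets_Collect_finite_All) auto
  then show ?thesis using space_F[OF assms] by (simp add: before_return_def)
qed

lemma before_return_mono: "s \<le> t \<Longrightarrow> before_return t \<subseteq> before_return s"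
  by (auto simp: before_return_def)

lemma sets_F: "1 \<le> t \<Longrightarrow> A \<in> sets (F t) \<Longrightarrow> A \<in> sets M"
  using filt_sub by (auto simp: subalgebra_def)

lemma X_L2: "1 \<le> t \<Longrightarrow> integrable M (\<lambda>\<omega>. (X t \<omega>)\<^sup>2)"
proof (induction t rule: dec_induct)
  case base
  have "integrable M (\<lambda>\<omega>. 0 :: real)" by simp
  then show ?case
    by (rule integrable_cong_AE_imp) (use start_AE in auto)
next
  case (step t)
  show ?case
  proof (rule Bochner_Integration.integrable_bound)
    show "integrable M (\<lambda>\<omega>. 2 * (X t \<omega>)\<^sup>2 + 2 * (X (t + 1) \<omega> - X t \<omega>)\<^sup>2)"
      using step Delta_L2[of t] by auto
    have "(X (Suc t) \<omega>)\<^sup>2 \<le> 2 * (X t \<omega>)\<^sup>2 + 2 * (X (t + 1) \<omega> - X t \<omega>)\<^sup>2" for \<omega>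
      using zero_le_power2[of "2 * X t \<omega> - X (Suc t) \<omega>"] by (simp add: power2_eq_square algebra_simps)
    then show "AE \<omega> in M. norm ((X (Suc t) \<omega>)\<^sup>2) \<le> norm (2 * (X t \<omega>)\<^sup>2 + 2 * (X (t + 1) \<omega> - X t \<omega>)\<^sup>2)"
      by auto
  qed (use step in measurable)
qed

lemma X_Delta_integrable:
  assumes "1 \<le> t" shows "integrable M (\<lambda>\<omega>. X t \<omega> * (X (t + 1) \<omega> - X t \<omega>))"
proof -
  have [measurable]: "X t \<in> borel_measurable M" "X (t + 1) \<in> borel_measurable M"
    using assms by auto
  show "integrable M (\<lambda>\<omega>. X t \<omega> * (X (t + 1) \<omega> - X t \<omega>))"
  proof (rule Bochner_Integration.integrable_bound)
    show "integrable M (\<lambda>\<omega>. (X t \<omega>)\<^sup>2 + (X (t + 1) \<omega> - X t \<omega>)\<^sup>2)"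
      using X_L2[OF assms] Delta_L2[OF assms] by simp
    have "\<bar>x * y\<bar> \<le> x\<^sup>2 + y\<^sup>2" for x y :: real
    proof -
      have "2 * (\<bar>x\<bar> * \<bar>y\<bar>) \<le> x\<^sup>2 + y\<^sup>2"
        using sum_squares_bound[of "\<bar>x\<bar>" "\<bar>y\<bar>"] by (simp add: mult.assoc)
      moreover have "0 \<le> \<bar>x\<bar> * \<bar>y\<bar>" by simp
      ultimately show ?thesis unfolding abs_mult by linarith
    qed
    then show "AE \<omega> in M. norm (X t \<omega> * (X (t + 1) \<omega> - X t \<omega>)) \<le> norm ((X t \<omega>)\<^sup>2 + (X (t + 1) \<omega> - X t \<omega>)\<^sup>2)"
      by (intro AE_I2) (auto intro: order_trans)
  qed measurable
qed

lemma drift_far: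
  obtains b \<epsilon> where "b \<ge> 0" "\<epsilon> > 0"
    "\<forall>t\<ge>1. \<forall>A\<in>sets (F t). (\<forall>\<omega>\<in>A. b < X t \<omega>) \<longrightarrow>
      (\<integral>\<omega>. indicator A \<omega> * (2 * (X t \<omega> * (X (t + 1) \<omega> - X t \<omega>)) + (X (t + 1) \<omega> - X t \<omega>)\<^sup>2) \<partial>M) \<le> - \<epsilon> * measure M A"
proof -
  define e where "e = - (2 * c + s2) / 6"
  have e: "e > 0"
    using r_gt s2_pos by (simp add: e_def field_simps)
  obtain x1 where x1: "\<And>t. 1 \<le> t \<Longrightarrow> AE \<omega> in M. X t \<omega> \<ge> x1 \<longrightarrow>
              \<bar>real_cond_exp M (F t) (\<lambda>\<omega>'. X (t + 1) \<omega>' - X t \<omega>') \<omega> - c / X t \<omega>\<bar>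
                \<le> e / (X t \<omega> * ln (X t \<omega>))"
    using A2_mean[OF e] by blast
  obtain x2 where x2: "\<And>t. 1 \<le> t \<Longrightarrow> AE \<omega> in M. X t \<omega> \<ge> x2 \<longrightarrow>
              \<bar>real_cond_exp M (F t) (\<lambda>\<omega>'. (X (t + 1) \<omega>' - X t \<omega>')\<^sup>2) \<omega> - s2\<bar>
                \<le> e / ln (X t \<omega>)"
    using A2_var[OF e] by blast
  define b where "b = max 3 (max x1 x2)"
  show thesis
  proof (rule that[of b "3 * e"]; (intro allI ballI impI)?)
    fix t A assume t: "1 \<le> t" and A: "A \<in> sets (F t)" and "\<forall>\<omega>\<in>A. b < X t \<omega>"
    then have Ab: "\<And>\<omega>. \<omega> \<in> A \<Longrightarrow> b < X t \<omega>" by blast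
    interpret sigma_finite_subalgebra M "F t" using t by (rule sigma_finite_subalgebra_F)
    have [measurable]: "X t \<in> borel_measurable M" "X (t + 1) \<in> borel_measurable M"
      "X t \<in> borel_measurable (F t)" "A \<in> sets M" "A \<in> sets (F t)"
      using t A sets_F[OF t A] X_measurable_F[of t t] by auto
    let ?D = "\<lambda>\<omega>. X (t + 1) \<omega> - X t \<omega>"
    let ?E1 = "real_cond_exp M (F t) ?D" and ?E2 = "real_cond_exp M (F t) (\<lambda>\<omega>. (?D \<omega>)\<^sup>2)"
    have i1: "integrable M (\<lambda>\<omega>. (indicator A \<omega> * (2 * X t \<omega>)) * ?D \<omega>)"
      using integrable_mult_indicator[of A M "\<lambda>\<omega>. 2 * (X t \<omega> * ?D \<omega>)"] X_Delta_integrable[OF t]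
      by (simp add: mult.assoc)
    have i2: "integrable M (\<lambda>\<omega>. indicator A \<omega> * (?D \<omega>)\<^sup>2)"
      using integrable_mult_indicator[of A M "\<lambda>\<omega>. (?D \<omega>)\<^sup>2"] Delta_L2[OF t] by simp
    have c1: "integrable M (\<lambda>\<omega>. (indicator A \<omega> * (2 * X t \<omega>)) * ?E1 \<omega>)"
      "(\<integral>\<omega>. (indicator A \<omega> * (2 * X t \<omega>)) * ?E1 \<omega> \<partial>M) = (\<integral>\<omega>. (indicator A \<omega> * (2 * X t \<omega>)) * ?D \<omega> \<partial>M)"
      by (rule real_cond_exp_intg[OF i1]; measurable)+
    have c2: "integrable M (\<lambda>\<omega>. indicator A \<omega> * ?E2 \<omega>)"
      "(\<integral>\<omega>. indicator A \<omega> * ?E2 \<omega> \<partial>M) = (\<integral>\<omega>. indicator A \<omega> * (?D \<omega>)\<^sup>2 \<partial>M)"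
      by (rule real_cond_exp_intg[OF i2]; measurable)+
    have "(\<integral>\<omega>. indicator A \<omega> * (2 * (X t \<omega> * ?D \<omega>) + (?D \<omega>)\<^sup>2) \<partial>M)
        = (\<integral>\<omega>. (indicator A \<omega> * (2 * X t \<omega>)) * ?D \<omega> + indicator A \<omega> * (?D \<omega>)\<^sup>2 \<partial>M)"
      by (intro Bochner_Integration.integral_cong) (auto simp: algebra_simps)
    also have "\<dots> = (\<integral>\<omega>. (indicator A \<omega> * (2 * X t \<omega>)) * ?E1 \<omega> + indicator A \<omega> * ?E2 \<omega> \<partial>M)"
      using i1 i2 c1 c2 by simp
    also have "\<dots> \<le> (\<integral>\<omega>. - (3 * e) * indicator A \<omega> \<partial>M)"
    proof (rule integral_mono_AE)
      show "AE \<omega> in M. indicator A \<omega> * (2 * X t \<omega>) * ?E1 \<omega> + indicator A \<omega> * ?E2 \<omega> \<le> - (3 * e) * indicator A \<omega>"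
        using x1[OF t] x2[OF t]
      proof eventually_elim
        case (elim \<omega>)
        show ?case
        proof (cases "\<omega> \<in> A")
          case True
          let ?x = "X t \<omega>"
          have x: "?x > 3" "?x \<ge> x1" "?x \<ge> x2" using Ab[OF True] by (auto simp: b_def)
          have "ln ?x \<ge> 1"
            using x e_less_272 by (subst ln_ge_iff) auto
          have "2 * ?x * ?E1 \<omega> \<le> 2 * ?x * (c / ?x + e / (?x * ln ?x))"
            using elim(1) x by (intro mult_left_mono) auto
          also have "\<dots> = 2 * c + 2 * (e / ln ?x)"
            using x by (simp add: field_simps)
          finally have *: "2 * ?x * ?E1 \<omega> \<le> 2 * c + 2 * (e / ln ?x)" .
          have "?E2 \<omega> \<le> s2 + e / ln ?x"
            using elim(2) x by auto
          moreover have "e / ln ?x \<le> e / 1"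
            using \<open>ln ?x \<ge> 1\<close> e by (intro divide_left_mono) auto
          ultimately have "2 * ?x * ?E1 \<omega> + ?E2 \<omega> \<le> 2 * c + s2 + 3 * e"
            using * by linarith
          also have "\<dots> = - (3 * e)" by (simp add: e_def field_simps)
          finally show ?thesis using True by simp
        qed simp
      qed
    qed (use c1 c2 in \<open>auto intro!: integrable_real_indicator simp: emeasure_eq_measure\<close>)
    also have "\<dots> = - (3 * e) * measure M A"
      by simp
    finally show "(\<integral>\<omega>. indicator A \<omega> * (2 * (X t \<omega> * ?D \<omega>) + (?D \<omega>)\<^sup>2) \<partial>M) \<le> - (3 * e) * measure M A" .
  qed (use e in \<open>auto simp: b_def\<close>)
qed

lemma second_moment_near:
  obtains K where "K \<ge> 0"
    "\<forall>t\<ge>1. \<forall>A\<in>sets (F t). (\<forall>\<omega>\<in>A. X t \<omega> \<le> b) \<longrightarrow>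
      (\<integral>\<omega>. indicator A \<omega> * (X (t + 1) \<omega> - X t \<omega>)\<^sup>2 \<partial>M) \<le> K * measure M A"
proof -
  obtain \<delta> C where C: "\<And>t. 1 \<le> t \<Longrightarrow> AE \<omega> in M.
              nn_cond_exp M (F t) (\<lambda>\<omega>'. ennreal (\<bar>X (t + 1) \<omega>' - X t \<omega>'\<bar> powr p)) \<omega>
                \<le> ennreal (C * (1 + X t \<omega>) powr (p - 2 - \<delta>))"
    using Mp by blast
  define K0 where "K0 = \<bar>C\<bar> * (1 + \<bar>b\<bar>) powr \<bar>p - 2 - \<delta>\<bar>"
  have K0: "K0 \<ge> 0" by (simp add: K0_def)
  have p2: "p \<ge> 2" using p_gt r_gt by simp
  show thesis
  proof (rule that[of "1 + K0"]; (intro allI ballI impI)?)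
    fix t A assume t: "1 \<le> t" and A: "A \<in> sets (F t)" and "\<forall>\<omega>\<in>A. X t \<omega> \<le> b"
    then have Ab: "\<And>\<omega>. \<omega> \<in> A \<Longrightarrow> X t \<omega> \<le> b" by blast
    interpret sigma_finite_subalgebra M "F t" using t by (rule sigma_finite_subalgebra_F)
    have [measurable]: "X t \<in> borel_measurable M" "X (t + 1) \<in> borel_measurable M"
      "X t \<in> borel_measurable (F t)" "A \<in> sets M" "A \<in> sets (F t)"
      using t A sets_F[OF t A] X_measurable_F[of t t] by auto
    let ?D = "\<lambda>\<omega>. X (t + 1) \<omega> - X t \<omega>"
    let ?P = "\<lambda>\<omega>. ennreal (\<bar>?D \<omega>\<bar> powr p)"
    have i2: "integrable M (\<lambda>\<omega>. indicator A \<omega> * (?D \<omega>)\<^sup>2)"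
      using integrable_mult_indicator[of A M "\<lambda>\<omega>. (?D \<omega>)\<^sup>2"] Delta_L2[OF t] by simp
    have sq: "x\<^sup>2 \<le> 1 + \<bar>x\<bar> powr p" for x :: real
    proof (cases "\<bar>x\<bar> \<le> 1")
      case True
      then have "x\<^sup>2 \<le> 1" by (simp add: abs_square_le_1)
      then show ?thesis by (smt (verit) powr_ge_zero)
    next
      case False
      have "x\<^sup>2 = \<bar>x\<bar> powr 2" using False by (simp add: powr_numeral)
      also have "\<dots> \<le> \<bar>x\<bar> powr p" using False p2 by (intro powr_mono) auto
      finally show ?thesis by simp
    qed
    have "ennreal (\<integral>\<omega>. indicator A \<omega> * (?D \<omega>)\<^sup>2 \<partial>M) = (\<integral>\<^sup>+\<omega>. ennreal (indicator A \<omega> * (?D \<omega>)\<^sup>2) \<partial>M)"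
      using i2 by (intro nn_integral_eq_integral[symmetric]) auto
    also have "\<dots> \<le> (\<integral>\<^sup>+\<omega>. indicator A \<omega> + indicator A \<omega> * ?P \<omega> \<partial>M)"
    proof (rule nn_integral_mono)
      fix \<omega>
      have "ennreal ((?D \<omega>)\<^sup>2) \<le> ennreal (1 + \<bar>?D \<omega>\<bar> powr p)"
        using sq by (rule ennreal_leI)
      then show "ennreal (indicator A \<omega> * (?D \<omega>)\<^sup>2) \<le> indicator A \<omega> + indicator A \<omega> * ?P \<omega>"
        by (auto simp: indicator_def)
    qed
    also have "\<dots> = emeasure M A + (\<integral>\<^sup>+\<omega>. indicator A \<omega> * ?P \<omega> \<partial>M)"
      by (subst nn_integral_add) auto
    also have "(\<integral>\<^sup>+\<omega>. indicator A \<omega> * ?P \<omega> \<partial>M) = (\<integral>\<^sup>+\<omega>. indicator A \<omega> * nn_cond_exp M (F t) ?P \<omega> \<partial>M)"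
      by (rule nn_cond_exp_intg[symmetric]) measurable
    also have "\<dots> \<le> (\<integral>\<^sup>+\<omega>. ennreal K0 * indicator A \<omega> \<partial>M)"
    proof (rule nn_integral_mono_AE)
      show "AE \<omega> in M. indicator A \<omega> * nn_cond_exp M (F t) ?P \<omega> \<le> ennreal K0 * indicator A \<omega>"
        using C[OF t] AE_space
      proof eventually_elim
        case (elim \<omega>)
        show ?case
        proof (cases "\<omega> \<in> A")
          case True
          have x: "0 \<le> X t \<omega>" "X t \<omega> \<le> b" using X_nonneg[OF t] elim Ab[OF True] by auto
          have "(1 + X t \<omega>) powr (p - 2 - \<delta>) \<le> (1 + X t \<omega>) powr \<bar>p - 2 - \<delta>\<bar>"
            using x by (intro powr_mono) auto
          also have "\<dots> \<le> (1 + \<bar>b\<bar>) powr \<bar>p - 2 - \<delta>\<bar>"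
            using x by (intro powr_mono2) auto
          finally have "C * (1 + X t \<omega>) powr (p - 2 - \<delta>) \<le> K0"
            unfolding K0_def by (intro mult_mono) auto
          then have "ennreal (C * (1 + X t \<omega>) powr (p - 2 - \<delta>)) \<le> ennreal K0"
            by (rule ennreal_leI)
          then show ?thesis using elim(1) True by simp
        qed simp
      qed
    qed
    also have "\<dots> = ennreal K0 * emeasure M A"
      by (subst nn_integral_cmult_indicator) auto
    finally have "ennreal (\<integral>\<omega>. indicator A \<omega> * (?D \<omega>)\<^sup>2 \<partial>M) \<le> ennreal ((1 + K0) * measure M A)"
      using K0 by (simp add: emeasure_eq_measure ennreal_mult[symmetric] ennreal_plus[symmetric] algebra_simps del: ennreal_plus)
    then show "(\<integral>\<omega>. indicator A \<omega> * (?D \<omega>)\<^sup>2 \<partial>M) \<le> (1 + K0) * measure M A"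
      using K0 by (subst (asm) ennreal_le_iff) auto
  qed (use K0 in auto)
qed

lemma hit_measurable:
  assumes "1 \<le> t"
  shows "{\<omega> \<in> space M. X (t + m (X t \<omega>)) \<omega> = y} \<in> sets M"
proof -
  have [measurable]: "X (t + k) \<in> borel_measurable M" "X t \<in> borel_measurable M" for k
    using assms by auto
  have "{\<omega> \<in> space M. X (t + m (X t \<omega>)) \<omega> = y} =
      (\<Union>x\<in>S. {\<omega> \<in> space M. X t \<omega> = x \<and> X (t + m x) \<omega> = y})"
    using S_valued[OF assms] by auto
  also have "\<dots> \<in> sets M"
    by (intro sets.countable_UN' countable_S) auto
  finally show ?thesis .
qed

lemma return_from_near:
  obtains q k where "q > 0"
    "\<forall>t\<ge>1. \<forall>A\<in>sets (F t). A \<subseteq> before_return t \<longrightarrow> (\<forall>\<omega>\<in>A. X t \<omega> \<le> b) \<longrightarrow>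
      q * measure M A \<le> measure M (before_return t) - measure M (before_return (t + k))"
proof -
  obtain m \<phi> where m: "\<And>x y. x \<in> S \<Longrightarrow> y \<in> S \<Longrightarrow> 1 \<le> m x y \<and> (0::real) < \<phi> x y"
    and hit: "\<And>y t. y \<in> S \<Longrightarrow> 1 \<le> t \<Longrightarrow> AE \<omega> in M.
                 real_cond_exp M (F t)
                   (indicator {\<omega>' \<in> space M. X (t + m (X t \<omega>') y) \<omega>' = y}) \<omega>
                 \<ge> \<phi> (X t \<omega>) y"
    using A1 by blast
  define q where "q = Min (insert 1 ((\<lambda>x. \<phi> x 0) ` (S \<inter> {..b})))"
  define k where "k = Max (insert 0 ((\<lambda>x. m x 0) ` (S \<inter> {..b})))"
  have q: "q \<le> \<phi> x 0" and k: "m x 0 \<le> k" if "x \<in> S" "x \<le> b" for x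
    using that S_locfin[of b] by (auto simp: q_def k_def intro!: Min_le Max_ge)
  have "q > 0"
    unfolding q_def using S_locfin[of b] m S_zero by (subst Min_gr_iff) auto
  then show thesis
  proof (rule that[of q k]; (intro allI ballI impI)?)
    fix t A assume t: "1 \<le> t" and A: "A \<in> sets (F t)" and sub: "A \<subseteq> before_return t"
      and "\<forall>\<omega>\<in>A. X t \<omega> \<le> b"
    then have Ab: "\<And>\<omega>. \<omega> \<in> A \<Longrightarrow> X t \<omega> \<le> b" by blast
    interpret sigma_finite_subalgebra M "F t" using t by (rule sigma_finite_subalgebra_F)
    have [measurable]: "A \<in> sets M" "A \<in> sets (F t)"
      using A sets_F[OF t A] by auto
    let ?H = "{\<omega>' \<in> space M. X (t + m (X t \<omega>') 0) \<omega>' = 0}"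
    have H[measurable]: "?H \<in> sets M" by (rule hit_measurable[OF t])
    have br[measurable]: "before_return s \<in> sets M" if "1 \<le> s" for s
      using before_return_F[OF that] sets_F[OF that] by auto
    have i: "integrable M (\<lambda>\<omega>. indicator A \<omega> * (indicator ?H \<omega> :: real))"
      using integrable_mult_indicator[of A M "indicator ?H :: _ \<Rightarrow> real"]
      by (simp add: integrable_real_indicator emeasure_eq_measure)
    have c: "integrable M (\<lambda>\<omega>. indicator A \<omega> * real_cond_exp M (F t) (indicator ?H) \<omega>)"
      "(\<integral>\<omega>. indicator A \<omega> * real_cond_exp M (F t) (indicator ?H) \<omega> \<partial>M) = (\<integral>\<omega>. indicator A \<omega> * indicator ?H \<omega> \<partial>M)"
      by (rule real_cond_exp_intg[OF i]; measurable)+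
    have "q * measure M A = (\<integral>\<omega>. q * indicator A \<omega> \<partial>M)" by simp
    also have "\<dots> \<le> (\<integral>\<omega>. indicator A \<omega> * real_cond_exp M (F t) (indicator ?H) \<omega> \<partial>M)"
    proof (rule integral_mono_AE)
      show "AE \<omega> in M. q * indicator A \<omega> \<le> indicator A \<omega> * real_cond_exp M (F t) (indicator ?H) \<omega>"
        using hit[OF S_zero t] AE_space
      proof eventually_elim
        case (elim \<omega>)
        then show ?case using q[of "X t \<omega>"] Ab[of \<omega>] S_valued[OF t, of \<omega>]
          by (auto simp: indicator_def)
      qed
    qed (use c in \<open>auto intro!: integrable_real_indicator simp: emeasure_eq_measure\<close>)
    also have "\<dots> = measure M (A \<inter> ?H)"
      unfolding c(2) indicator_inter_arith[symmetric] by simp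
    also have "\<dots> \<le> measure M (before_return t - before_return (t + k))"
    proof (rule finite_measure_mono)
      show "A \<inter> ?H \<subseteq> before_return t - before_return (t + k)"
      proof
        fix \<omega> assume \<omega>: "\<omega> \<in> A \<inter> ?H"
        have x: "X t \<omega> \<in> S" "X t \<omega> \<le> b" using \<omega> Ab S_valued[OF t] by auto
        let ?s = "t + m (X t \<omega>) 0"
        have "?s \<in> {2..t + k}"
          using k[OF x] m[OF x(1) S_zero] t by auto
        moreover have "X ?s \<omega> = 0" using \<omega> by auto
        ultimately show "\<omega> \<in> before_return t - before_return (t + k)"
          using \<omega> sub by (auto simp: before_return_def)
      qed
    qed (use br t in auto)
    also have "\<dots> = measure M (before_return t) - measure M (before_return (t + k))"
      using br t by (intro finite_measure_Diff before_return_mono) auto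
    finally show "q * measure M A \<le> measure M (before_return t) - measure M (before_return (t + k))" .
  qed
qed

theorem expected_return_time_finite:
  "(\<integral>\<^sup>+ \<omega>. ennreal_of_enat (eta X 1 \<omega>) \<partial>M) < \<infinity>"
proof -
  obtain b \<epsilon> where b: "b \<ge> 0" and \<epsilon>: "\<epsilon> > 0" and far:
    "\<forall>t\<ge>1. \<forall>A\<in>sets (F t). (\<forall>\<omega>\<in>A. b < X t \<omega>) \<longrightarrow>
      (\<integral>\<omega>. indicator A \<omega> * (2 * (X t \<omega> * (X (t + 1) \<omega> - X t \<omega>)) + (X (t + 1) \<omega> - X t \<omega>)\<^sup>2) \<partial>M) \<le> - \<epsilon> * measure M A"
    by (rule drift_far) blast
  obtain K0 where K0: "K0 \<ge> 0" and near:
    "\<forall>t\<ge>1. \<forall>A\<in>sets (F t). (\<forall>\<omega>\<in>A. X t \<omega> \<le> b) \<longrightarrow>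
      (\<integral>\<omega>. indicator A \<omega> * (X (t + 1) \<omega> - X t \<omega>)\<^sup>2 \<partial>M) \<le> K0 * measure M A"
    by (rule second_moment_near[of b]) blast
  obtain q k where q: "q > 0" and return:
    "\<forall>t\<ge>1. \<forall>A\<in>sets (F t). A \<subseteq> before_return t \<longrightarrow> (\<forall>\<omega>\<in>A. X t \<omega> \<le> b) \<longrightarrow>
      q * measure M A \<le> measure M (before_return t) - measure M (before_return (t + k))"
    by (rule return_from_near[of b]) blast
  define K where "K = b\<^sup>2 + 2 * K0"
  have K: "K \<ge> 0" using K0 by (simp add: K_def)
  define D where "D t = {\<omega> \<in> before_return t. b < X t \<omega>}" for t
  define B where "B t = {\<omega> \<in> before_return t. X t \<omega> \<le> b}" for t
  define V where "V t = (\<integral>\<omega>. indicator (before_return t) \<omega> * (X t \<omega>)\<^sup>2 \<partial>M)" for t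
  have DB_F: "D t \<in> sets (F t)" "B t \<in> sets (F t)" if t: "1 \<le> t" for t
  proof -
    have [measurable]: "X t \<in> borel_measurable (F t)" "before_return t \<in> sets (F t)"
      using X_measurable_F[of t t] before_return_F t by auto
    have "before_return t \<subseteq> space (F t)" using t space_F by (auto simp: before_return_def)
    then have "D t = before_return t \<inter> {\<omega> \<in> space (F t). b < X t \<omega>}"
      "B t = before_return t \<inter> {\<omega> \<in> space (F t). X t \<omega> \<le> b}"
      by (auto simp: D_def B_def)
    then show "D t \<in> sets (F t)" "B t \<in> sets (F t)" by simp_all
  qed
  have br[measurable]: "before_return s \<in> sets M" if "1 \<le> s" for s
    using before_return_F[OF that] sets_F[OF that] by auto
  have DB[measurable]: "D t \<in> sets M" "B t \<in> sets M" if "1 \<le> t" for t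
    using DB_F sets_F that by auto
  have split: "measure M (before_return t) = measure M (D t) + measure M (B t)" if "1 \<le> t" for t
  proof -
    have "before_return t = D t \<union> B t" "D t \<inter> B t = {}" by (auto simp: D_def B_def)
    then show ?thesis using finite_measure_Union[OF DB[OF that]] by simp
  qed
  have step: "V (Suc t) \<le> V t - \<epsilon> * measure M (D t) + K * measure M (B t)" if t: "1 \<le> t" for t
  proof -
    let ?D = "\<lambda>\<omega>. X (t + 1) \<omega> - X t \<omega>"
    let ?G = "\<lambda>\<omega>. 2 * (X t \<omega> * ?D \<omega>) + (?D \<omega>)\<^sup>2"
    have [measurable]: "X t \<in> borel_measurable M" "X (Suc t) \<in> borel_measurable M"
       "D t \<in> sets M" "B t \<in> sets M" "before_return t \<in> sets M" "before_return (Suc t) \<in> sets M"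
      using t DB br by auto
    have iG: "integrable M ?G"
      using X_Delta_integrable[OF t] Delta_L2[OF t] by simp
    have ind: "integrable M (\<lambda>\<omega>. indicator A \<omega> * h \<omega>)" if "A \<in> sets M" "integrable M h" for A and h :: "'a \<Rightarrow> real"
      using integrable_mult_indicator[OF that] by simp
    have "V (Suc t) \<le> (\<integral>\<omega>. indicator (before_return t) \<omega> * (X (Suc t) \<omega>)\<^sup>2 \<partial>M)"
      unfolding V_def
    proof (rule integral_mono)
      show "indicator (before_return (Suc t)) \<omega> * (X (Suc t) \<omega>)\<^sup>2 \<le> indicator (before_return t) \<omega> * (X (Suc t) \<omega>)\<^sup>2" for \<omega>
        using before_return_mono[of t "Suc t"] by (auto simp: indicator_def)
    qed (intro ind X_L2; simp)+
    also have "\<dots> = (\<integral>\<omega>. indicator (before_return t) \<omega> * (X t \<omega>)\<^sup>2 + (indicator (D t) \<omega> * ?G \<omega> + indicator (B t) \<omega> * ?G \<omega>) \<partial>M)"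
      by (intro Bochner_Integration.integral_cong refl)
         (auto simp: indicator_def D_def B_def power2_eq_square algebra_simps)
    also have "\<dots> = V t + ((\<integral>\<omega>. indicator (D t) \<omega> * ?G \<omega> \<partial>M) + (\<integral>\<omega>. indicator (B t) \<omega> * ?G \<omega> \<partial>M))"
      unfolding V_def using ind[of "before_return t", OF _ X_L2[OF t]] ind[of "D t", OF _ iG] ind[of "B t", OF _ iG]
      by simp
    also have "(\<integral>\<omega>. indicator (D t) \<omega> * ?G \<omega> \<partial>M) \<le> - \<epsilon> * measure M (D t)"
      by (rule far[rule_format, OF t DB_F(1)[OF t]]) (auto simp: D_def)
    also have "(\<integral>\<omega>. indicator (B t) \<omega> * ?G \<omega> \<partial>M) \<le> (\<integral>\<omega>. b\<^sup>2 * indicator (B t) \<omega> + 2 * (indicator (B t) \<omega> * (?D \<omega>)\<^sup>2) \<partial>M)"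
    proof (rule integral_mono)
      show "integrable M (\<lambda>\<omega>. b\<^sup>2 * indicator (B t) \<omega> + 2 * (indicator (B t) \<omega> * (?D \<omega>)\<^sup>2))"
        using ind[of "B t", OF _ Delta_L2[OF t]]
        by (intro Bochner_Integration.integrable_add integrable_mult_right integrable_real_indicator)
           (auto simp: emeasure_eq_measure)
      show "indicator (B t) \<omega> * ?G \<omega> \<le> b\<^sup>2 * indicator (B t) \<omega> + 2 * (indicator (B t) \<omega> * (?D \<omega>)\<^sup>2)"
        if "\<omega> \<in> space M" for \<omega>
      proof (cases "\<omega> \<in> B t")
        case True
        then have "0 \<le> X t \<omega>" "X t \<omega> \<le> b" using X_nonneg[OF t that] by (auto simp: B_def)
        then have "(X t \<omega>)\<^sup>2 \<le> b\<^sup>2" by (rule power_mono[rotated])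
        moreover have "2 * (X t \<omega> * ?D \<omega>) \<le> (X t \<omega>)\<^sup>2 + (?D \<omega>)\<^sup>2"
          using sum_squares_bound[of "X t \<omega>" "?D \<omega>"] by (simp only: mult.assoc)
        ultimately show ?thesis using True by simp
      qed simp
    qed (use ind[of "B t", OF _ iG] in auto)
    also have "\<dots> = b\<^sup>2 * measure M (B t) + 2 * (\<integral>\<omega>. indicator (B t) \<omega> * (?D \<omega>)\<^sup>2 \<partial>M)"
      using ind[of "B t", OF _ Delta_L2[OF t]]
      by (subst Bochner_Integration.integral_add)
         (auto intro!: integrable_real_indicator simp: emeasure_eq_measure)
    also have "(\<integral>\<omega>. indicator (B t) \<omega> * (?D \<omega>)\<^sup>2 \<partial>M) \<le> K0 * measure M (B t)"
      by (rule near[rule_format, OF t DB_F(2)[OF t]]) (auto simp: B_def)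
    finally show ?thesis by (simp add: K_def algebra_simps)
  qed
  have V1: "V 1 = 0"
    unfolding V_def using start_AE by (intro integral_eq_zero_AE) auto
  have Vn: "V t \<ge> 0" for t
    unfolding V_def by (intro integral_nonneg_AE) auto
  have tele: "V (Suc n) + \<epsilon> * (\<Sum>t=1..n. measure M (D t)) \<le> K * (\<Sum>t=1..n. measure M (B t))" for n
  proof (induction n)
    case 0 then show ?case using V1 by simp
  next
    case (Suc n)
    then show ?case using step[of "Suc n"] by (simp add: algebra_simps)
  qed
  have sumB: "(\<Sum>t=1..n. measure M (B t)) \<le> k / q" for n
  proof -
    have "q * (\<Sum>t=1..n. measure M (B t)) \<le> (\<Sum>t=1..n. measure M (before_return t) - measure M (before_return (t + k)))"
      unfolding sum_distrib_left
    proof (rule sum_mono)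
      fix t assume "t \<in> {1..n}"
      then show "q * measure M (B t) \<le> measure M (before_return t) - measure M (before_return (t + k))"
        by (intro return[rule_format] DB_F) (auto simp: B_def)
    qed
    also have "\<dots> = (\<Sum>t<n. measure M (before_return (Suc t)) - measure M (before_return (Suc t + k)))"
      by (rule sum.reindex_bij_witness[of _ Suc "\<lambda>t. t - 1"]) auto
    also have "\<dots> \<le> k"
      using sum_shift_diff_le[of "\<lambda>t. measure M (before_return (Suc t))" k n] by simp
    finally show ?thesis using q by (simp add: field_simps)
  qed
  have sumA: "(\<Sum>t<n. measure M (before_return (Suc t))) \<le> (K / \<epsilon> + 1) * (k / q)" for n
  proof -
    have "(\<Sum>t<n. measure M (before_return (Suc t))) = (\<Sum>t=1..n. measure M (before_return t))"
      by (rule sum.reindex_bij_witness[of _ "\<lambda>t. t - 1" Suc]) auto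
    also have "\<dots> = (\<Sum>t=1..n. measure M (D t)) + (\<Sum>t=1..n. measure M (B t))"
      unfolding sum.distrib[symmetric] by (intro sum.cong split) auto
    also have "(\<Sum>t=1..n. measure M (D t)) \<le> (K / \<epsilon>) * (\<Sum>t=1..n. measure M (B t))"
      using tele[of n] Vn[of "Suc n"] \<epsilon> by (simp add: field_simps)
    finally have "(\<Sum>t<n. measure M (before_return (Suc t))) \<le> (K / \<epsilon> + 1) * (\<Sum>t=1..n. measure M (B t))"
      by (simp add: algebra_simps)
    also have "\<dots> \<le> (K / \<epsilon> + 1) * (k / q)"
      using sumB[of n] K \<epsilon> by (intro mult_left_mono) auto
    finally show ?thesis .
  qed
  have summable: "summable (\<lambda>t. measure M (before_return (Suc t)))"
    by (rule summableI_nonneg_bounded[OF _ sumA]) auto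
  have [measurable]: "eta X 1 \<in> measurable M (count_space UNIV)"
  proof -
    have "(\<lambda>\<omega>. tau X 1 \<omega> - 1) \<in> measurable M (count_space UNIV)"
      by (rule measurable_compose[OF tau_measurable, where g = "\<lambda>a. a - 1"]) auto
    then show ?thesis by (simp only: eta_1_eq[symmetric])
  qed
  have "(\<integral>\<^sup>+ \<omega>. ennreal_of_enat (eta X 1 \<omega>) \<partial>M) = (\<Sum>t. emeasure M {\<omega> \<in> space M. enat t < eta X 1 \<omega>})"
    by (rule nn_integral_enat_function) measurable
  also have "\<dots> = (\<Sum>t. ennreal (measure M (before_return (Suc t))))"
    unfolding less_eta_1_iff before_return_def by (simp add: emeasure_eq_measure)
  also have "\<dots> < \<infinity>"
    using summable by (subst suminf_ennreal2) auto
  finally show ?thesis .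
qed

end

section \<open>Excursions\<close>

definition path_length :: "(nat \<Rightarrow> real option) \<Rightarrow> nat" where
  "path_length y = (LEAST k. y k = None)"

definition path_occ :: "real \<Rightarrow> (nat \<Rightarrow> real option) \<Rightarrow> nat" where
  "path_occ x y = card {k. k < path_length y \<and> y k = Some x}"

text \<open>Time is counted from 0 here, whereas \<^const>\<open>tau\<close> starts at 1.\<close>

definition renewal_time :: "(nat \<Rightarrow> 'a \<Rightarrow> real) \<Rightarrow> nat \<Rightarrow> 'a \<Rightarrow> nat" where
  "renewal_time X n \<omega> = the_enat (tau X n \<omega>) - 1"

lemma path_component_measurable [measurable]: "(\<lambda>y. y k) \<in> measurable path_space (count_space UNIV)"
  unfolding path_space_def by measurable

lemma path_length_measurable [measurable]: "path_length \<in> measurable path_space (count_space UNIV)"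
  unfolding path_length_def[abs_def] by measurable

lemma path_occ_measurable [measurable]: "path_occ x \<in> measurable path_space (count_space UNIV)"
proof -
  have "path_occ x = (\<lambda>y. \<Sum>k<path_length y. if y k = Some x then 1 else 0)"
    by (simp add: path_occ_def sum.If_cases lessThan_def Int_def fun_eq_iff)
  moreover have "(\<lambda>y. \<Sum>k<path_length y. if y k = Some x then 1 else 0 :: nat) \<in> measurable path_space (count_space UNIV)"
    by (rule measurable_compose_countable[OF _ path_length_measurable]) measurable
  ultimately show ?thesis by simp
qed

lemma path_occ_le_length: "path_occ x y \<le> path_length y"
  unfolding path_occ_def using card_mono[of "{..<path_length y}" "{k. k < path_length y \<and> y k = Some x}"] by auto

context
  fixes X :: "nat \<Rightarrow> 'a \<Rightarrow> real" and \<omega> :: 'a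
  assumes finite_returns: "\<And>n. tau X n \<omega> \<noteq> \<infinity>"
begin

lemma tau_eq_renewal_time: "tau X n \<omega> = enat (Suc (renewal_time X n \<omega>))"
  using finite_returns[of n] tau_ge_1[of X n \<omega>] unfolding renewal_time_def
  by (cases "tau X n \<omega>") (auto simp: one_enat_def)

lemma renewal_time_0: "renewal_time X 0 \<omega> = 0"
  by (simp add: renewal_time_def one_enat_def)

lemma renewal_time_less_Suc: "renewal_time X n \<omega> < renewal_time X (Suc n) \<omega>"
  using tau_Suc_eq_enat_iff[of X n \<omega> "Suc (renewal_time X (Suc n) \<omega>)"]
  unfolding tau_eq_renewal_time by auto

lemma strict_mono_renewal_time: "strict_mono (\<lambda>n. renewal_time X n \<omega>)"
  unfolding strict_mono_Suc_iff using renewal_time_less_Suc by blast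

lemma excursion_eq:
  "excursion X (Suc n) \<omega> k = (if renewal_time X n \<omega> + k < renewal_time X (Suc n) \<omega>
     then Some (X (Suc (renewal_time X n \<omega> + k)) \<omega>) else None)"
  unfolding excursion_def by (simp add: tau_eq_renewal_time del: tau.simps)

lemma path_length_excursion:
  "path_length (excursion X (Suc n) \<omega>) = renewal_time X (Suc n) \<omega> - renewal_time X n \<omega>"
  unfolding path_length_def using renewal_time_less_Suc[of n]
  by (intro Least_equality) (auto simp: excursion_eq split: if_splits)

lemma renewal_time_eq_sum: "renewal_time X n \<omega> = (\<Sum>i<n. path_length (excursion X (Suc i) \<omega>))"
proof (induction n)
  case (Suc n)
  then show ?case using renewal_time_less_Suc[of n] by (simp add: path_length_excursion)
qed (simp add: renewal_time_0)

lemma excursion_beyond_length: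
  "excursion X (Suc n) \<omega> k = Some x \<Longrightarrow> k < path_length (excursion X (Suc n) \<omega>)"
  by (auto simp: path_length_excursion excursion_eq split: if_splits)

lemma path_occ_excursion:
  "path_occ x (excursion X (Suc n) \<omega>) =
     card {t \<in> {renewal_time X n \<omega><..renewal_time X (Suc n) \<omega>}. X t \<omega> = x}"
proof -
  let ?T = "\<lambda>n. renewal_time X n \<omega>"
  have "bij_betw (\<lambda>k. Suc (?T n + k)) {k. k < path_length (excursion X (Suc n) \<omega>) \<and> excursion X (Suc n) \<omega> k = Some x}
      {t \<in> {?T n<..?T (Suc n)}. X t \<omega> = x}"
    by (rule bij_betw_byWitness[where f' = "\<lambda>t. t - Suc (?T n)"])
       (auto simp: path_length_excursion excursion_eq split: if_splits)
  then show ?thesis unfolding path_occ_def by (rule bij_betw_same_card)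
qed

lemma occ_renewal_time:
  "occ X (renewal_time X n \<omega>) x \<omega> = (\<Sum>i<n. path_occ x (excursion X (Suc i) \<omega>))"
proof (induction n)
  case (Suc n)
  let ?T = "\<lambda>n. renewal_time X n \<omega>"
  have "{s \<in> {1..?T (Suc n)}. X s \<omega> = x} =
     {s \<in> {1..?T n}. X s \<omega> = x} \<union> {t \<in> {?T n<..?T (Suc n)}. X t \<omega> = x}"
    using renewal_time_less_Suc[of n] by auto
  then have "occ X (?T (Suc n)) x \<omega> = occ X (?T n) x \<omega> + card {t \<in> {?T n<..?T (Suc n)}. X t \<omega> = x}"
    unfolding occ_def by (simp only:) (subst card_Un_disjoint; auto)
  then show ?case using Suc by (simp add: path_occ_excursion)
qed (simp add: occ_def renewal_time_0)

lemma eta_1_eq_path_length: "eta X 1 \<omega> = enat (path_length (excursion X 1 \<omega>))"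
  unfolding eta_1_eq using path_length_excursion[of 0] tau_eq_renewal_time[of 1]
  by (simp add: renewal_time_0 one_enat_def del: tau.simps)

lemma ell_1_eq_path_occ: "ell X 1 x \<omega> = of_nat (path_occ x (excursion X 1 \<omega>))"
proof -
  let ?T = "\<lambda>n. renewal_time X n \<omega>"
  have *: "tau X (1 - 1) \<omega> \<le> enat t \<and> enat t < tau X 1 \<omega> \<and> X t \<omega> = x \<longleftrightarrow> t \<in> {t \<in> {?T 0<..?T 1}. X t \<omega> = x}" for t
    using tau_eq_renewal_time[of 1] by (auto simp: renewal_time_0 one_enat_def)
  have "ell X 1 x \<omega> = (\<Sum>t\<in>{t \<in> {?T 0<..?T 1}. X t \<omega> = x}. 1)"
    unfolding ell_def * by (subst suminf_finite[of "{t \<in> {?T 0<..?T 1}. X t \<omega> = x}"]) auto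
  then show ?thesis using path_occ_excursion[of x 0] by simp
qed

lemma state_indicator_decomposition:
  "(\<Sum>n\<le>m. \<Sum>s\<le>m. if renewal_time X n \<omega> = s \<and> excursion X (Suc n) \<omega> (m - s) = Some x then 1 else 0)
     = (if X (Suc m) \<omega> = x then 1 else 0 :: real)"
proof -
  let ?T = "\<lambda>n. renewal_time X n \<omega>"
  have inc: "n \<le> ?T n" for n
    by (rule strict_mono_imp_increasing[OF strict_mono_renewal_time])
  define N where "N = Max {n. ?T n \<le> m}"
  have fin: "finite {n. ?T n \<le> m}"
    by (rule finite_subset[of _ "{..m}"]) (use inc in \<open>auto intro: le_trans\<close>)
  have "0 \<in> {n. ?T n \<le> m}" by (simp add: renewal_time_0)
  then have N1: "?T N \<le> m"
    using Max_in[OF fin] unfolding N_def by blast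
  have N2: "m < ?T (Suc N)"
    using Max_ge[OF fin, of "Suc N"] by (auto simp: N_def[symmetric] not_le[symmetric])
  have uniq: "n = N" if "?T n \<le> m" "m < ?T (Suc n)" for n
  proof -
    have "n \<le> N" using that(1) Max_ge[OF fin, of n] by (simp add: N_def)
    moreover have "N < Suc n"
      using strict_mono_less[OF strict_mono_renewal_time, of N "Suc n"] that(2) N1 by simp
    ultimately show ?thesis by simp
  qed
  have "(\<Sum>s\<le>m. if ?T n = s \<and> excursion X (Suc n) \<omega> (m - s) = Some x then 1 else 0 :: real)
      = (if n = N then (if X (Suc m) \<omega> = x then 1 else 0) else 0)" for n
  proof -
    have "(\<Sum>s\<le>m. if ?T n = s \<and> excursion X (Suc n) \<omega> (m - s) = Some x then 1 else 0 :: real)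
       = (\<Sum>s\<le>m. if s = ?T n then (if excursion X (Suc n) \<omega> (m - ?T n) = Some x then 1 else 0) else 0)"
      by (intro sum.cong) auto
    also have "\<dots> = (if ?T n \<le> m \<and> excursion X (Suc n) \<omega> (m - ?T n) = Some x then 1 else 0)"
      by (subst sum.delta) auto
    also have "?T n \<le> m \<and> excursion X (Suc n) \<omega> (m - ?T n) = Some x \<longleftrightarrow> n = N \<and> X (Suc m) \<omega> = x"
      using N1 N2 uniq[of n] by (cases "?T n \<le> m") (auto simp: excursion_eq)
    also have "(if n = N \<and> X (Suc m) \<omega> = x then 1 else 0 :: real) = (if n = N then (if X (Suc m) \<omega> = x then 1 else 0) else 0)"
      by simp
    finally show ?thesis .
  qed
  then show ?thesis
    using inc[of N] N1 by simp
qed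

end

section \<open>Limit theorems for independent excursions\<close>

lemma sum_rev_atMost: "(\<Sum>s\<le>m. g s (m - s)) = (\<Sum>k\<le>m. g (m - k) (k::nat))"
  by (rule sum.reindex_bij_witness[of _ "\<lambda>k. m - k" "\<lambda>k. m - k"]) auto

locale iid_excursions = prob_space M for M :: "'a measure" +
  fixes X :: "nat \<Rightarrow> 'a \<Rightarrow> real" and S :: "real set"
  assumes X_meas: "\<And>t. 1 \<le> t \<Longrightarrow> X t \<in> borel_measurable M"
    and X_in_S: "\<And>t \<omega>. 1 \<le> t \<Longrightarrow> \<omega> \<in> space M \<Longrightarrow> X t \<omega> \<in> S"
    and S_countable: "countable S" and S_infinite: "infinite S"
    and finite_returns: "AE \<omega> in M. \<forall>n. tau X n \<omega> \<noteq> \<infinity>"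
    and indep_excursions: "indep_vars (\<lambda>_. path_space) (\<lambda>n. excursion X (Suc n)) UNIV"
    and ident_excursions: "\<And>n. distr M path_space (excursion X (Suc n)) = distr M path_space (excursion X 1)"
    and mean_finite: "(\<integral>\<^sup>+ \<omega>. ennreal_of_enat (eta X 1 \<omega>) \<partial>M) < \<infinity>"
    and reachable: "\<And>x. x \<in> S \<Longrightarrow> \<exists>t\<ge>1. prob {\<omega> \<in> space M. X t \<omega> = x} > 0"
begin

abbreviation Y :: "nat \<Rightarrow> 'a \<Rightarrow> nat \<Rightarrow> real option" where
  "Y n \<equiv> excursion X (Suc n)"

definition exc_length :: "nat \<Rightarrow> 'a \<Rightarrow> nat" where "exc_length n \<omega> = path_length (Y n \<omega>)"

definition exc_occ :: "real \<Rightarrow> nat \<Rightarrow> 'a \<Rightarrow> nat" where "exc_occ x n \<omega> = path_occ x (Y n \<omega>)"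

definition length_sum :: "nat \<Rightarrow> 'a \<Rightarrow> nat" where "length_sum n \<omega> = (\<Sum>i<n. exc_length i \<omega>)"

definition mean_length :: real where "mean_length = expectation (\<lambda>\<omega>. real (exc_length 0 \<omega>))"

definition mean_occ :: "real \<Rightarrow> real" where "mean_occ x = expectation (\<lambda>\<omega>. real (exc_occ x 0 \<omega>))"

lemma Y_measurable [measurable]: "Y n \<in> measurable M path_space"
  using indep_excursions by (auto simp: indep_vars_def)

lemma exc_length_measurable [measurable]: "exc_length n \<in> measurable M (count_space UNIV)"
  unfolding exc_length_def[abs_def] by measurable

lemma exc_occ_measurable [measurable]: "exc_occ x n \<in> measurable M (count_space UNIV)"
  unfolding exc_occ_def[abs_def] by measurable

lemma length_sum_measurable [measurable]: "length_sum n \<in> measurable M (count_space UNIV)"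
  unfolding length_sum_def[abs_def] by measurable

lemma X_eq_measurable: "1 \<le> t \<Longrightarrow> {\<omega> \<in> space M. X t \<omega> = x} \<in> sets M"
  using X_meas[of t] by measurable

lemma AE_length_sum_eq: "AE \<omega> in M. \<forall>n. length_sum n \<omega> = renewal_time X n \<omega>"
  using finite_returns by eventually_elim (simp add: length_sum_def exc_length_def renewal_time_eq_sum)

lemma AE_exc_length_pos: "AE \<omega> in M. \<forall>n. exc_length n \<omega> \<ge> 1"
  using finite_returns
proof eventually_elim
  case (elim \<omega>)
  then have "renewal_time X n \<omega> < renewal_time X (Suc n) \<omega>" for n
    by (intro renewal_time_less_Suc) auto
  then show ?case using elim by (simp add: exc_length_def path_length_excursion Suc_le_eq)
qed

lemma AE_le_length_sum: "AE \<omega> in M. \<forall>n. n \<le> length_sum n \<omega>"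
  using AE_exc_length_pos
proof eventually_elim
  case (elim \<omega>)
  show ?case
  proof
    show "n \<le> length_sum n \<omega>" for n
      using sum_mono[of "{..<n}" "\<lambda>_. 1" "\<lambda>i. exc_length i \<omega>"] elim by (simp add: length_sum_def)
  qed
qed

lemma nn_integral_eta: "(\<integral>\<^sup>+ \<omega>. ennreal_of_enat (eta X 1 \<omega>) \<partial>M) = (\<integral>\<^sup>+ \<omega>. ennreal (real (exc_length 0 \<omega>)) \<partial>M)"
proof (rule nn_integral_cong_AE)
  show "AE \<omega> in M. ennreal_of_enat (eta X 1 \<omega>) = ennreal (real (exc_length 0 \<omega>))"
    using finite_returns
  proof eventually_elim
    case (elim \<omega>)
    then have "eta X 1 \<omega> = enat (exc_length 0 \<omega>)"
      unfolding exc_length_def using eta_1_eq_path_length[of X \<omega>] by simp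
    then show ?case by (simp add: ennreal_of_nat_eq_real_of_nat)
  qed
qed

lemma nn_integral_ell: "(\<integral>\<^sup>+ \<omega>. ell X 1 x \<omega> \<partial>M) = (\<integral>\<^sup>+ \<omega>. ennreal (real (exc_occ x 0 \<omega>)) \<partial>M)"
proof (rule nn_integral_cong_AE)
  show "AE \<omega> in M. ell X 1 x \<omega> = ennreal (real (exc_occ x 0 \<omega>))"
    using finite_returns
  proof eventually_elim
    case (elim \<omega>)
    then have "ell X 1 x \<omega> = of_nat (exc_occ x 0 \<omega>)"
      unfolding exc_occ_def using ell_1_eq_path_occ[of X \<omega> x] by simp
    then show ?case by (simp add: ennreal_of_nat_eq_real_of_nat)
  qed
qed

lemma exc_length_integrable: "integrable M (\<lambda>\<omega>. real (exc_length 0 \<omega>))"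
  using mean_finite unfolding nn_integral_eta by (intro integrableI_nonneg) auto

lemma exc_occ_integrable: "integrable M (\<lambda>\<omega>. real (exc_occ x 0 \<omega>))"
  by (rule Bochner_Integration.integrable_bound[OF exc_length_integrable])
     (auto simp: exc_occ_def exc_length_def path_occ_le_length)

lemma mean_length_ge_1: "mean_length \<ge> 1"
proof -
  have "expectation (\<lambda>\<omega>. 1) \<le> mean_length"
    unfolding mean_length_def using AE_exc_length_pos exc_length_integrable by (intro integral_mono_AE) auto
  then show ?thesis by (simp add: prob_space)
qed

lemma stat_pi_eq: "stat_pi M X x = mean_occ x / mean_length"
proof -
  have "(\<integral>\<^sup>+ \<omega>. ell X 1 x \<omega> \<partial>M) = ennreal (mean_occ x)"
    unfolding nn_integral_ell mean_occ_def by (intro nn_integral_eq_integral exc_occ_integrable) auto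
  moreover have "(\<integral>\<^sup>+ \<omega>. ennreal_of_enat (eta X 1 \<omega>) \<partial>M) = ennreal mean_length"
    unfolding nn_integral_eta mean_length_def by (intro nn_integral_eq_integral exc_length_integrable) auto
  moreover have "mean_occ x \<ge> 0" unfolding mean_occ_def by simp
  ultimately show ?thesis
    unfolding stat_pi_def using mean_length_ge_1 by (simp add: divide_ennreal)
qed

lemma functional_distr:
  fixes g :: "(nat \<Rightarrow> real option) \<Rightarrow> real"
  assumes [measurable]: "g \<in> borel_measurable path_space"
  shows "distr M borel (\<lambda>\<omega>. g (Y n \<omega>)) = distr M borel (\<lambda>\<omega>. g (Y 0 \<omega>))"
proof -
  have "distr M borel (\<lambda>\<omega>. g (Y n \<omega>)) = distr (distr M path_space (Y n)) borel g" for n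
    by (subst distr_distr) (auto simp: o_def)
  then show ?thesis using ident_excursions[of n] by simp
qed

lemma functional_integral:
  fixes g :: "(nat \<Rightarrow> real option) \<Rightarrow> real"
  assumes g[measurable]: "g \<in> borel_measurable path_space" and int: "integrable M (\<lambda>\<omega>. g (Y 0 \<omega>))"
  shows "integrable M (\<lambda>\<omega>. g (Y n \<omega>))" "expectation (\<lambda>\<omega>. g (Y n \<omega>)) = expectation (\<lambda>\<omega>. g (Y 0 \<omega>))"
proof -
  have meas: "(\<lambda>\<omega>. g (Y n \<omega>)) \<in> borel_measurable M" for n by measurable
  have "integrable (distr M borel (\<lambda>\<omega>. g (Y 0 \<omega>))) (\<lambda>r. r)"
    by (subst integrable_distr_eq[OF meas]) (auto intro: int)
  then have "integrable (distr M borel (\<lambda>\<omega>. g (Y n \<omega>))) (\<lambda>r. r)"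
    by (simp only: functional_distr[OF g, of n])
  then show "integrable M (\<lambda>\<omega>. g (Y n \<omega>))"
    by (subst (asm) integrable_distr_eq[OF meas]) auto
  have "expectation (\<lambda>\<omega>. g (Y n \<omega>)) = (\<integral>r. r \<partial>distr M borel (\<lambda>\<omega>. g (Y n \<omega>)))"
    by (subst integral_distr[OF meas]) auto
  also have "\<dots> = (\<integral>r. r \<partial>distr M borel (\<lambda>\<omega>. g (Y 0 \<omega>)))"
    by (simp only: functional_distr[OF g, of n])
  also have "\<dots> = expectation (\<lambda>\<omega>. g (Y 0 \<omega>))"
    by (subst integral_distr[OF meas]) auto
  finally show "expectation (\<lambda>\<omega>. g (Y n \<omega>)) = expectation (\<lambda>\<omega>. g (Y 0 \<omega>))" .
qed

lemma functional_slln: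
  fixes g :: "(nat \<Rightarrow> real option) \<Rightarrow> real"
  assumes g[measurable]: "g \<in> borel_measurable path_space" and int: "integrable M (\<lambda>\<omega>. g (Y 0 \<omega>))"
  shows "AE \<omega> in M. (\<lambda>n. (\<Sum>i<n. g (Y i \<omega>)) / n) \<longlonglongrightarrow> expectation (\<lambda>\<omega>. g (Y 0 \<omega>))"
proof (rule strong_law_of_large_numbers[of "\<lambda>i \<omega>. g (Y i \<omega>)", OF _ functional_distr[OF g] int])
  show "indep_vars (\<lambda>_. borel) (\<lambda>i \<omega>. g (Y i \<omega>)) UNIV"
    by (rule indep_vars_compose2[OF indep_excursions, of "\<lambda>_. g"]) auto
qed

theorem occ_average_AE: "AE \<omega> in M. (\<lambda>t. real (occ X t x \<omega>) / real t) \<longlonglongrightarrow> stat_pi M X x"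
proof -
  have "AE \<omega> in M. (\<lambda>n. (\<Sum>i<n. real (path_length (Y i \<omega>))) / n) \<longlonglongrightarrow> mean_length"
    unfolding mean_length_def exc_length_def
    by (rule functional_slln[of "\<lambda>y. real (path_length y)"]) (use exc_length_integrable in \<open>auto simp: exc_length_def\<close>)
  moreover have "AE \<omega> in M. (\<lambda>n. (\<Sum>i<n. real (path_occ x (Y i \<omega>))) / n) \<longlonglongrightarrow> mean_occ x"
    unfolding mean_occ_def exc_occ_def
    by (rule functional_slln[of "\<lambda>y. real (path_occ x y)"]) (use exc_occ_integrable in \<open>auto simp: exc_occ_def\<close>)
  ultimately show ?thesis
    using finite_returns
  proof eventually_elim
    case (elim \<omega>)
    have fin: "\<And>n. tau X n \<omega> \<noteq> \<infinity>" using elim(3) by blast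
    let ?T = "\<lambda>n. renewal_time X n \<omega>"
    show ?case
      unfolding stat_pi_eq
    proof (rule average_tendsto_of_subsequence[of ?T])
      show "strict_mono ?T" using fin by (rule strict_mono_renewal_time)
      show "?T 0 = 0" using fin by (rule renewal_time_0)
      show "mono (\<lambda>t. real (occ X t x \<omega>))"
        unfolding occ_def by (intro monoI of_nat_mono card_mono) auto
      show "(\<lambda>n. real (?T n) / real n) \<longlonglongrightarrow> mean_length"
        using elim(1) fin by (simp add: renewal_time_eq_sum)
      show "(\<lambda>n. real (occ X (?T n) x \<omega>) / real n) \<longlonglongrightarrow> mean_occ x"
        using elim(2) fin by (simp add: occ_renewal_time)
    qed (use mean_length_ge_1 in auto)
  qed
qed

lemma occ_measurable: "(\<lambda>\<omega>. real (occ X t x \<omega>)) \<in> borel_measurable M"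
proof -
  have [measurable]: "{\<omega> \<in> space M. X s \<omega> = x} \<in> sets M" if "s \<in> {1..t}" for s
    using X_eq_measurable that by auto
  have "(\<lambda>\<omega>. \<Sum>s\<in>{1..t}. indicator {\<omega> \<in> space M. X s \<omega> = x} \<omega> :: real) \<in> borel_measurable M"
    by (intro borel_measurable_sum borel_measurable_indicator) auto
  also have "?this \<longleftrightarrow> ?thesis"
    by (intro measurable_cong) (simp add: occ_def indicator_def sum.If_cases Int_def)
  finally show ?thesis .
qed

theorem occ_average_Lq:
  fixes q :: real
  assumes q: "q \<ge> 1"
  shows "(\<lambda>t. \<integral>\<^sup>+ \<omega>. ennreal (\<bar>real (occ X t x \<omega>) / real t - stat_pi M X x\<bar> powr q) \<partial>M) \<longlonglongrightarrow> 0"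
proof -
  let ?d = "\<lambda>t \<omega>. ennreal (\<bar>real (occ X t x \<omega>) / real t - stat_pi M X x\<bar> powr q)"
  let ?B = "(1 + \<bar>stat_pi M X x\<bar>) powr q"
  have occ_le: "occ X t x \<omega> \<le> t" for t \<omega>
  proof -
    have "occ X t x \<omega> \<le> card {1..t}" unfolding occ_def by (rule card_mono) auto
    then show ?thesis by simp
  qed
  have "(\<lambda>t. \<integral>\<^sup>+ \<omega>. ?d t \<omega> \<partial>M) \<longlonglongrightarrow> (\<integral>\<^sup>+ \<omega>. 0 \<partial>M)"
  proof (rule nn_integral_dominated_convergence[where w = "\<lambda>_. ennreal ?B"])
    show "?d t \<in> borel_measurable M" for t
      using occ_measurable[of t x] by measurable
    show "AE \<omega> in M. ?d t \<omega> \<le> ennreal ?B" for t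
    proof (intro AE_I2 ennreal_leI powr_mono2)
      fix \<omega>
      have "\<bar>real (occ X t x \<omega>) / real t\<bar> \<le> 1"
        using occ_le[of t \<omega>] by (cases "t = 0") (auto simp: field_simps)
      then show "\<bar>real (occ X t x \<omega>) / real t - stat_pi M X x\<bar> \<le> 1 + \<bar>stat_pi M X x\<bar>"
        by linarith
    qed (use q in auto)
    show "(\<integral>\<^sup>+ \<omega>. ennreal ?B \<partial>M) < \<infinity>"
      by (simp add: emeasure_space_1)
    show "AE \<omega> in M. (\<lambda>t. ?d t \<omega>) \<longlonglongrightarrow> 0"
      using occ_average_AE[of x]
    proof eventually_elim
      case (elim \<omega>)
      have "(\<lambda>t. \<bar>real (occ X t x \<omega>) / real t - stat_pi M X x\<bar> powr q) \<longlonglongrightarrow> 0 powr q"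
      proof (rule tendsto_powr2)
        show "(\<lambda>t. \<bar>real (occ X t x \<omega>) / real t - stat_pi M X x\<bar>) \<longlonglongrightarrow> 0"
          using tendsto_rabs[OF tendsto_diff[OF elim tendsto_const[of "stat_pi M X x"]]] by simp
      qed (use q in auto)
      then have "(\<lambda>t. ?d t \<omega>) \<longlonglongrightarrow> ennreal (0 powr q)"
        by (rule tendsto_ennrealI)
      then show ?case by simp
    qed
  qed auto
  then show ?thesis by simp
qed

theorem stat_pi_pos:
  assumes "x \<in> S" shows "stat_pi M X x > 0"
proof (rule ccontr)
  assume "\<not> stat_pi M X x > 0"
  then have "\<not> 0 < mean_occ x" unfolding stat_pi_eq using mean_length_ge_1 by auto
  moreover have "mean_occ x \<ge> 0" unfolding mean_occ_def by simp
  ultimately have z: "mean_occ x = 0" by simp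
  have "AE \<omega> in M. path_occ x (Y n \<omega>) = 0" for n
  proof -
    have "expectation (\<lambda>\<omega>. real (path_occ x (Y n \<omega>))) = 0" "integrable M (\<lambda>\<omega>. real (path_occ x (Y n \<omega>)))"
      using functional_integral[of "\<lambda>y. real (path_occ x y)" n] exc_occ_integrable[of x] z
      by (auto simp: mean_occ_def exc_occ_def)
    then show ?thesis
      by (subst (asm) integral_nonneg_eq_0_iff_AE) auto
  qed
  then have "AE \<omega> in M. \<forall>n. path_occ x (Y n \<omega>) = 0"
    by (simp add: AE_all_countable)
  then have never: "AE \<omega> in M. \<forall>t\<ge>1. X t \<omega> \<noteq> x"
    using finite_returns
  proof eventually_elim
    case (elim \<omega>)
    show ?case
    proof safe
      fix t assume t: "1 \<le> t" "x = X t \<omega>"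
      let ?T = "\<lambda>n. renewal_time X n \<omega>"
      have "t \<le> ?T t"
        using elim by (intro strict_mono_imp_increasing strict_mono_renewal_time) auto
      then have "t \<in> {s \<in> {1..?T t}. X s \<omega> = x}" using t by auto
      moreover have "card {s \<in> {1..?T t}. X s \<omega> = x} = 0"
        using occ_renewal_time[of X \<omega> t x] elim unfolding occ_def by simp
      ultimately show False by (subst (asm) card_0_eq) auto
    qed
  qed
  obtain t where t: "t \<ge> 1" "prob {\<omega> \<in> space M. X t \<omega> = x} > 0"
    using reachable[OF assms] by blast
  have "AE \<omega> in M. \<not> X t \<omega> = x" using never t by auto
  then have "prob {\<omega> \<in> space M. X t \<omega> = x} = 0"
    using X_eq_measurable[OF t(1)] by (subst prob_Collect_eq_0) auto
  then show False using t by simp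
qed

theorem stat_pi_has_sum: "(stat_pi M X has_sum 1) S"
proof -
  obtain e :: "nat \<Rightarrow> real" where e: "bij_betw e UNIV S"
    using bij_betw_from_nat_into[OF S_countable S_infinite] by blast
  have "AE \<omega> in M. (\<Sum>n. ennreal (real (exc_occ (e n) 0 \<omega>))) = ennreal (real (exc_length 0 \<omega>))"
    using finite_returns AE_space
  proof eventually_elim
    case (elim \<omega>)
    have fin: "\<And>n. tau X n \<omega> \<noteq> \<infinity>" using elim(1) by blast
    let ?A = "\<lambda>x. {t \<in> {0<..renewal_time X 1 \<omega>}. X t \<omega> = x}"
    have Gc: "exc_occ x 0 \<omega> = card (?A x)" for x
      unfolding exc_occ_def using path_occ_excursion[OF fin, of x 0] renewal_time_0[OF fin] by simp
    have Hc: "exc_length 0 \<omega> = card {0<..renewal_time X 1 \<omega>}"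
      unfolding exc_length_def using path_length_excursion[OF fin, of 0] renewal_time_0[OF fin] by simp
    have "(\<Sum>n. ennreal (real (exc_occ (e n) 0 \<omega>))) =
        (\<Sum>n. \<Sum>t\<in>{0<..renewal_time X 1 \<omega>}. if X t \<omega> = e n then 1 else 0)"
      by (simp add: Gc sum.If_cases Int_def ennreal_of_nat_eq_real_of_nat)
    also have "\<dots> = (\<Sum>t\<in>{0<..renewal_time X 1 \<omega>}. \<Sum>n. if X t \<omega> = e n then 1 else 0)"
      by (rule suminf_sum) auto
    also have "\<dots> = (\<Sum>t\<in>{0<..renewal_time X 1 \<omega>}. 1)"
    proof (rule sum.cong[OF refl])
      fix t assume "t \<in> {0<..renewal_time X 1 \<omega>}"
      then have "X t \<omega> \<in> S" using X_in_S[of t \<omega>] elim by auto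
      then obtain n where n: "X t \<omega> = e n" using e by (auto simp: bij_betw_def)
      have "X t \<omega> = e n' \<longleftrightarrow> n' = n" for n'
        using e n by (auto simp: bij_betw_def inj_def)
      then show "(\<Sum>n. if X t \<omega> = e n then 1 else 0 :: ennreal) = 1"
        by (subst suminf_finite[of "{n}"]) auto
    qed
    also have "\<dots> = ennreal (real (exc_length 0 \<omega>))" by (simp add: Hc ennreal_of_nat_eq_real_of_nat)
    finally show ?case .
  qed
  then have "(\<integral>\<^sup>+ \<omega>. (\<Sum>n. ennreal (real (exc_occ (e n) 0 \<omega>))) \<partial>M) = (\<integral>\<^sup>+ \<omega>. ennreal (real (exc_length 0 \<omega>)) \<partial>M)"
    by (rule nn_integral_cong_AE)
  also have "(\<integral>\<^sup>+ \<omega>. (\<Sum>n. ennreal (real (exc_occ (e n) 0 \<omega>))) \<partial>M) = (\<Sum>n. \<integral>\<^sup>+ \<omega>. ennreal (real (exc_occ (e n) 0 \<omega>)) \<partial>M)"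
    by (rule nn_integral_suminf) measurable
  also have "\<dots> = (\<Sum>n. ennreal (mean_occ (e n)))"
    unfolding mean_occ_def by (intro suminf_cong nn_integral_eq_integral exc_occ_integrable) auto
  also have "(\<integral>\<^sup>+ \<omega>. ennreal (real (exc_length 0 \<omega>)) \<partial>M) = ennreal mean_length"
    unfolding mean_length_def by (intro nn_integral_eq_integral exc_length_integrable) auto
  finally have sum: "(\<Sum>n. ennreal (mean_occ (e n))) = ennreal mean_length" .
  have nn: "mean_occ x \<ge> 0" for x unfolding mean_occ_def by simp
  have "(\<lambda>n. mean_occ (e n)) sums mean_length"
  proof -
    have "(\<lambda>n. ennreal (mean_occ (e n))) sums ennreal mean_length"
      unfolding sum[symmetric] by (rule summable_sums) auto
    then show ?thesis
      using nn mean_length_ge_1 by (subst (asm) sums_ennreal) auto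
  qed
  then have "(\<lambda>n. mean_occ (e n) / mean_length) sums (mean_length / mean_length)"
    by (rule sums_divide)
  then have "(\<lambda>n. stat_pi M X (e n)) sums 1"
    using mean_length_ge_1 by (simp add: stat_pi_eq)
  then have "((\<lambda>n. stat_pi M X (e n)) has_sum 1) UNIV"
    using nn mean_length_ge_1 by (intro sums_nonneg_imp_has_sum) (auto simp: stat_pi_eq)
  then show ?thesis
    using has_sum_reindex_bij_betw[OF e] by blast
qed

lemma prob_renewal_and_excursion:
  assumes [measurable]: "B \<in> sets path_space"
  shows "prob {\<omega> \<in> space M. length_sum n \<omega> = s \<and> Y n \<omega> \<in> B} = prob {\<omega> \<in> space M. length_sum n \<omega> = s} * prob {\<omega> \<in> space M. Y 0 \<omega> \<in> B}"
proof -
  let ?N = "\<lambda>_::nat. path_space"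
  define t :: "(nat \<Rightarrow> nat \<Rightarrow> real option) \<Rightarrow> nat" where "t z = (\<Sum>i<n. path_length (z i))" for z
  have [measurable]: "t \<in> measurable (PiM {..<n} ?N) (count_space UNIV)"
  proof -
    have [measurable]: "(\<lambda>z. path_length (z i)) \<in> measurable (PiM {..<n} ?N) (count_space UNIV)" if "i \<in> {..<n}" for i
      using that by (intro measurable_compose[OF measurable_component_singleton[of i "{..<n}" ?N] path_length_measurable]) auto
    show ?thesis unfolding t_def[abs_def] by measurable
  qed
  have "indep_var (PiM {..<n} ?N) (\<lambda>\<omega>. restrict (\<lambda>i. Y i \<omega>) {..<n}) (PiM {n} ?N) (\<lambda>\<omega>. restrict (\<lambda>i. Y i \<omega>) {n})"
    by (rule indep_var_restrict[OF indep_excursions]) auto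
  then have "indep_var (count_space UNIV) (t \<circ> (\<lambda>\<omega>. restrict (\<lambda>i. Y i \<omega>) {..<n}))
      (count_space UNIV) ((\<lambda>z. if z n \<in> B then 1 else 0) \<circ> (\<lambda>\<omega>. restrict (\<lambda>i. Y i \<omega>) {n}))"
    by (rule indep_var_compose) measurable
  moreover have "t \<circ> (\<lambda>\<omega>. restrict (\<lambda>i. Y i \<omega>) {..<n}) = length_sum n"
    by (auto simp: t_def length_sum_def exc_length_def fun_eq_iff)
  ultimately have "indep_var (count_space UNIV) (length_sum n) (count_space UNIV) (\<lambda>\<omega>. if Y n \<omega> \<in> B then 1 else 0)"
    by (simp add: o_def)
  from indep_varD[OF this, of "{s}" "{1}"]
  have "prob ((\<lambda>\<omega>. (length_sum n \<omega>, if Y n \<omega> \<in> B then 1 else 0)) -` ({s} \<times> {1::nat}) \<inter> space M) =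
      prob (length_sum n -` {s} \<inter> space M) * prob ((\<lambda>\<omega>. if Y n \<omega> \<in> B then 1 else 0) -` {1::nat} \<inter> space M)"
    by simp
  also have "(\<lambda>\<omega>. (length_sum n \<omega>, if Y n \<omega> \<in> B then 1 else 0)) -` ({s} \<times> {1::nat}) \<inter> space M
      = {\<omega> \<in> space M. length_sum n \<omega> = s \<and> Y n \<omega> \<in> B}"
    by (auto split: if_splits)
  also have "(\<lambda>\<omega>. if Y n \<omega> \<in> B then 1 else 0) -` {1::nat} \<inter> space M = Y n -` B \<inter> space M"
    by (auto split: if_splits)
  also have "length_sum n -` {s} \<inter> space M = {\<omega> \<in> space M. length_sum n \<omega> = s}" by auto
  also have "prob (Y n -` B \<inter> space M) = prob (Y 0 -` B \<inter> space M)"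
    using measure_distr[of "Y n" M path_space B] measure_distr[of "Y 0" M path_space B] ident_excursions[of n]
    by simp
  also have "Y 0 -` B \<inter> space M = {\<omega> \<in> space M. Y 0 \<omega> \<in> B}" by auto
  finally show ?thesis .
qed

definition length_prob :: "nat \<Rightarrow> real" where "length_prob k = prob {\<omega> \<in> space M. exc_length 0 \<omega> = k}"

definition renewal_prob :: "nat \<Rightarrow> real" where "renewal_prob m = (\<Sum>n\<le>m. prob {\<omega> \<in> space M. length_sum n \<omega> = m})"

lemma prob_length_sum_eq_0:
  assumes "s < n" shows "prob {\<omega> \<in> space M. length_sum n \<omega> = s} = 0"
proof -
  have "AE \<omega> in M. length_sum n \<omega> \<noteq> s"
    using AE_le_length_sum by eventually_elim (use assms in \<open>auto simp: not_le[symmetric]\<close>)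
  then show ?thesis by (subst prob_Collect_eq_0) measurable
qed

lemma renewal_prob_eq: "s \<le> m \<Longrightarrow> renewal_prob s = (\<Sum>n\<le>m. prob {\<omega> \<in> space M. length_sum n \<omega> = s})"
  unfolding renewal_prob_def by (rule sum.mono_neutral_left) (auto simp: prob_length_sum_eq_0)

lemma length_prob_0_eq: "length_prob 0 = 0"
proof -
  have "AE \<omega> in M. exc_length 0 \<omega> \<noteq> 0"
    using AE_exc_length_pos by eventually_elim (metis not_one_le_zero)
  then show ?thesis unfolding length_prob_def by (subst prob_Collect_eq_0) measurable
qed

lemma prob_length_sum_Suc: "prob {\<omega> \<in> space M. length_sum (Suc n) \<omega> = m} = (\<Sum>s\<le>m. prob {\<omega> \<in> space M. length_sum n \<omega> = s} * length_prob (m - s))"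
proof -
  have "prob {\<omega> \<in> space M. length_sum (Suc n) \<omega> = m} =
     prob (\<Union>s\<in>{..m}. {\<omega> \<in> space M. length_sum n \<omega> = s \<and> Y n \<omega> \<in> {y \<in> space path_space. path_length y = m - s}})"
    using measurable_space[OF Y_measurable[of n]]
    by (intro arg_cong[of _ _ prob]) (auto simp: length_sum_def exc_length_def)
  also have "\<dots> = (\<Sum>s\<le>m. prob {\<omega> \<in> space M. length_sum n \<omega> = s \<and> Y n \<omega> \<in> {y \<in> space path_space. path_length y = m - s}})"
    by (rule finite_measure_finite_Union) (auto simp: disjoint_family_on_def)
  also have "\<dots> = (\<Sum>s\<le>m. prob {\<omega> \<in> space M. length_sum n \<omega> = s} * length_prob (m - s))"
  proof (rule sum.cong[OF refl])
    fix s
    have "{\<omega> \<in> space M. Y 0 \<omega> \<in> {y \<in> space path_space. path_length y = m - s}} = {\<omega> \<in> space M. exc_length 0 \<omega> = m - s}"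
      using measurable_space[OF Y_measurable[of 0]] by (auto simp: exc_length_def)
    then show "prob {\<omega> \<in> space M. length_sum n \<omega> = s \<and> Y n \<omega> \<in> {y \<in> space path_space. path_length y = m - s}}
       = prob {\<omega> \<in> space M. length_sum n \<omega> = s} * length_prob (m - s)"
      unfolding length_prob_def by (subst prob_renewal_and_excursion) auto
  qed
  finally show ?thesis .
qed

lemma renewal_prob_convolution:
  assumes "m \<ge> 1" shows "renewal_prob m = (\<Sum>k\<le>m. length_prob k * renewal_prob (m - k))"
proof -
  obtain m' where m': "m = Suc m'" using assms by (cases m) auto
  have "renewal_prob m = prob {\<omega> \<in> space M. length_sum 0 \<omega> = m} + (\<Sum>n\<le>m'. prob {\<omega> \<in> space M. length_sum (Suc n) \<omega> = m})"
    unfolding renewal_prob_def m' by (rule sum.atMost_Suc_shift)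
  also have "prob {\<omega> \<in> space M. length_sum 0 \<omega> = m} = 0" using assms by (simp add: length_sum_def)
  also have "(\<Sum>n\<le>m'. prob {\<omega> \<in> space M. length_sum (Suc n) \<omega> = m})
      = (\<Sum>s\<le>m. (\<Sum>n\<le>m'. prob {\<omega> \<in> space M. length_sum n \<omega> = s}) * length_prob (m - s))"
    unfolding prob_length_sum_Suc sum_distrib_right by (rule sum.swap)
  also have "\<dots> = (\<Sum>s\<le>m. renewal_prob s * length_prob (m - s))"
  proof (rule sum.cong[OF refl])
    fix s assume s: "s \<in> {..m}"
    show "(\<Sum>n\<le>m'. prob {\<omega> \<in> space M. length_sum n \<omega> = s}) * length_prob (m - s) = renewal_prob s * length_prob (m - s)"
      using s renewal_prob_eq[of s m'] by (cases "s = m") (auto simp: length_prob_0_eq m')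
  qed
  also have "\<dots> = (\<Sum>k\<le>m. renewal_prob (m - k) * length_prob k)"
    by (rule sum_rev_atMost)
  finally show ?thesis by (simp add: mult.commute)
qed

lemma length_prob_sums_1: "length_prob sums 1"
proof -
  have "(\<lambda>k. prob {\<omega> \<in> space M. exc_length 0 \<omega> = k}) sums prob (\<Union>k. {\<omega> \<in> space M. exc_length 0 \<omega> = k})"
    by (rule finite_measure_UNION) (auto simp: disjoint_family_on_def)
  moreover have "(\<Union>k. {\<omega> \<in> space M. exc_length 0 \<omega> = k}) = space M" by auto
  ultimately show ?thesis by (simp add: length_prob_def[abs_def] prob_space)
qed

lemma length_prob_tail: "1 - (\<Sum>j\<le>k. length_prob j) = prob {\<omega> \<in> space M. k < exc_length 0 \<omega>}"
proof -
  have "(\<Sum>j\<le>k. length_prob j) = prob (\<Union>j\<in>{..k}. {\<omega> \<in> space M. exc_length 0 \<omega> = j})"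
    unfolding length_prob_def by (rule finite_measure_finite_Union[symmetric]) (auto simp: disjoint_family_on_def)
  also have "(\<Union>j\<in>{..k}. {\<omega> \<in> space M. exc_length 0 \<omega> = j}) = space M - {\<omega> \<in> space M. k < exc_length 0 \<omega>}" by auto
  also have "prob \<dots> = 1 - prob {\<omega> \<in> space M. k < exc_length 0 \<omega>}" by (rule prob_compl) measurable
  finally show ?thesis by simp
qed

lemma length_prob_tail_sums: "(\<lambda>k. 1 - (\<Sum>j\<le>k. length_prob j)) sums mean_length"
proof -
  have "ennreal mean_length = (\<integral>\<^sup>+ \<omega>. ennreal_of_enat (enat (exc_length 0 \<omega>)) \<partial>M)"
    unfolding mean_length_def using exc_length_integrable
    by (subst nn_integral_eq_integral[symmetric]) (auto simp: ennreal_of_nat_eq_real_of_nat)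
  also have "\<dots> = (\<Sum>t. emeasure M {\<omega> \<in> space M. enat t < enat (exc_length 0 \<omega>)})"
    by (rule nn_integral_enat_function) measurable
  also have "\<dots> = (\<Sum>t. ennreal (1 - (\<Sum>j\<le>t. length_prob j)))"
    by (simp add: length_prob_tail emeasure_eq_measure)
  finally have "(\<lambda>t. ennreal (1 - (\<Sum>j\<le>t. length_prob j))) sums ennreal mean_length"
    by (metis summable_sums summableI)
  then show ?thesis
    using mean_length_ge_1 by (subst (asm) sums_ennreal) (auto simp: length_prob_tail)
qed

lemma renewal_prob_nonneg: "renewal_prob n \<ge> 0"
  unfolding renewal_prob_def by (simp add: sum_nonneg)

lemma renewal_prob_0: "renewal_prob 0 = 1"
  by (simp add: renewal_prob_def length_sum_def prob_space)

lemma renewal_prob_le_1: "renewal_prob n \<le> 1"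
proof (induction n rule: less_induct)
  case (less n)
  show ?case
  proof (cases "n = 0")
    case False
    have "renewal_prob n = (\<Sum>k\<le>n. length_prob k * renewal_prob (n - k))" using False by (intro renewal_prob_convolution) simp
    also have "\<dots> \<le> (\<Sum>k\<le>n. length_prob k)"
    proof (rule sum_mono)
      fix k assume "k \<in> {..n}"
      show "length_prob k * renewal_prob (n - k) \<le> length_prob k"
      proof (cases "k = 0")
        case False
        then have "renewal_prob (n - k) \<le> 1" using \<open>n \<noteq> 0\<close> by (intro less) auto
        then show ?thesis by (simp add: length_prob_def mult_left_le)
      qed (simp add: length_prob_0_eq)
    qed
    also have "\<dots> \<le> 1" using length_prob_tail[of n] measure_nonneg[of M] by (smt (verit))
    finally show ?thesis .
  qed (simp add: renewal_prob_0)
qed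

lemma renewal_prob_tendsto:
  assumes aperiodic: "\<And>k. k > 1 \<Longrightarrow> prob {\<omega> \<in> space M. eta X 1 \<omega> \<in> enat ` {k * j | j. 1 \<le> j}} \<noteq> 1"
  shows "renewal_prob \<longlonglongrightarrow> 1 / mean_length"
proof -
  interpret renewal_sequence length_prob renewal_prob mean_length 1
  proof
    show "\<exists>k. length_prob k > 0 \<and> \<not> d dvd k" if d: "1 < d" for d
    proof (rule ccontr)
      assume "\<nexists>k. 0 < length_prob k \<and> \<not> d dvd k"
      then have "length_prob k = 0" if "\<not> d dvd k" for k
        using that by (auto simp: length_prob_def less_le)
      then have "AE \<omega> in M. \<not> d dvd k \<longrightarrow> exc_length 0 \<omega> \<noteq> k" for k
        unfolding length_prob_def by (cases "d dvd k") (auto simp: prob_Collect_eq_0)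
      then have "AE \<omega> in M. \<forall>k. \<not> d dvd k \<longrightarrow> exc_length 0 \<omega> \<noteq> k"
        by (simp add: AE_all_countable)
      then have "AE \<omega> in M. eta X 1 \<omega> \<in> enat ` {d * j | j. 1 \<le> j}"
        using AE_exc_length_pos finite_returns
      proof eventually_elim
        case (elim \<omega>)
        have "d dvd exc_length 0 \<omega>" using elim(1) by blast
        then obtain j where j: "exc_length 0 \<omega> = d * j" by (rule dvdE)
        have "exc_length 0 \<omega> \<ge> 1" using elim(2) by blast
        then have "1 \<le> j" using j by (cases j) auto
        moreover have "eta X 1 \<omega> = enat (exc_length 0 \<omega>)"
          unfolding exc_length_def using elim(3) eta_1_eq_path_length[of X \<omega>] by simp
        ultimately show ?case using j by auto
      qed
      moreover have "{\<omega> \<in> space M. eta X 1 \<omega> \<in> enat ` {d * j | j. 1 \<le> j}} \<in> sets M"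
      proof -
        have [measurable]: "tau X 1 \<in> measurable M (count_space UNIV)"
          using X_meas by (rule tau_measurable)
        show ?thesis unfolding eta_1_eq by measurable
      qed
      ultimately have "prob {\<omega> \<in> space M. eta X 1 \<omega> \<in> enat ` {d * j | j. 1 \<le> j}} = 1"
        by (subst prob_Collect_eq_1) auto
      then show False using aperiodic[OF d] by simp
    qed
    show "length_prob k \<ge> 0" for k by (simp add: length_prob_def)
    show "\<bar>renewal_prob n\<bar> \<le> 1" for n using renewal_prob_nonneg[of n] renewal_prob_le_1[of n] by simp
  qed (use mean_length_ge_1 in \<open>auto intro: length_prob_0_eq length_prob_sums_1 length_prob_tail_sums renewal_prob_convolution\<close>)
  show ?thesis using renewal_theorem by (simp add: renewal_prob_0)
qed

lemma prob_state_eq: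
  "prob {\<omega> \<in> space M. X (Suc m) \<omega> = x} = (\<Sum>k\<le>m. prob {\<omega> \<in> space M. Y 0 \<omega> k = Some x} * renewal_prob (m - k))"
proof -
  define B where "B k = {y \<in> space path_space. y k = Some x}" for k
  have [measurable]: "B k \<in> sets path_space" for k
    unfolding B_def by measurable
  have B: "Y n \<omega> \<in> B k \<longleftrightarrow> Y n \<omega> k = Some x" if "\<omega> \<in> space M" for n \<omega> k
    using measurable_space[OF Y_measurable that] by (simp add: B_def)
  let ?E = "\<lambda>n s. {\<omega> \<in> space M. length_sum n \<omega> = s \<and> Y n \<omega> \<in> B (m - s)}"
  have "prob {\<omega> \<in> space M. X (Suc m) \<omega> = x} = (\<integral>\<omega>. indicator {\<omega> \<in> space M. X (Suc m) \<omega> = x} \<omega> \<partial>M)"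
    using X_eq_measurable[of "Suc m" x] by simp
  also have "\<dots> = (\<integral>\<omega>. (\<Sum>n\<le>m. \<Sum>s\<le>m. indicator (?E n s) \<omega>) \<partial>M)"
  proof (rule integral_cong_AE)
    show "AE \<omega> in M. indicator {\<omega> \<in> space M. X (Suc m) \<omega> = x} \<omega> = (\<Sum>n\<le>m. \<Sum>s\<le>m. indicator (?E n s) \<omega> :: real)"
      using finite_returns AE_length_sum_eq AE_space
    proof eventually_elim
      case (elim \<omega>)
      have "(\<Sum>n\<le>m. \<Sum>s\<le>m. indicator (?E n s) \<omega> :: real) =
        (\<Sum>n\<le>m. \<Sum>s\<le>m. if renewal_time X n \<omega> = s \<and> excursion X (Suc n) \<omega> (m - s) = Some x then 1 else 0)"
        using elim B by (intro sum.cong refl) (simp add: indicator_def)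
      also have "\<dots> = (if X (Suc m) \<omega> = x then 1 else 0)"
        using elim(1) by (intro state_indicator_decomposition) auto
      finally show ?case using elim by (simp add: indicator_def)
    qed
    show "(\<lambda>\<omega>. indicator {\<omega> \<in> space M. X (Suc m) \<omega> = x} \<omega> :: real) \<in> borel_measurable M"
      using X_eq_measurable[of "Suc m" x] by simp
  qed measurable
  also have "\<dots> = (\<Sum>n\<le>m. \<Sum>s\<le>m. prob (?E n s))"
    by (simp add: Bochner_Integration.integral_sum emeasure_eq_measure)
  also have "\<dots> = (\<Sum>s\<le>m. \<Sum>n\<le>m. prob (?E n s))"
    by (rule sum.swap)
  also have "\<dots> = (\<Sum>s\<le>m. renewal_prob s * prob {\<omega> \<in> space M. Y 0 \<omega> (m - s) = Some x})"
  proof (rule sum.cong[OF refl])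
    fix s assume s: "s \<in> {..m}"
    have "{\<omega> \<in> space M. Y 0 \<omega> \<in> B (m - s)} = {\<omega> \<in> space M. Y 0 \<omega> (m - s) = Some x}"
      using B by auto
    then have "prob (?E n s) = prob {\<omega> \<in> space M. length_sum n \<omega> = s} * prob {\<omega> \<in> space M. Y 0 \<omega> (m - s) = Some x}" for n
      by (subst prob_renewal_and_excursion) auto
    then show "(\<Sum>n\<le>m. prob (?E n s)) = renewal_prob s * prob {\<omega> \<in> space M. Y 0 \<omega> (m - s) = Some x}"
      using renewal_prob_eq[of s m] s by (simp add: sum_distrib_right)
  qed
  also have "\<dots> = (\<Sum>k\<le>m. renewal_prob (m - k) * prob {\<omega> \<in> space M. Y 0 \<omega> k = Some x})"
    by (rule sum_rev_atMost)
  finally show ?thesis by (simp add: mult.commute)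
qed

theorem state_tendsto:
  assumes aperiodic: "\<And>k. k > 1 \<Longrightarrow> prob {\<omega> \<in> space M. eta X 1 \<omega> \<in> enat ` {k * j | j. 1 \<le> j}} \<noteq> 1"
  shows "(\<lambda>t. prob {\<omega> \<in> space M. X t \<omega> = x}) \<longlonglongrightarrow> stat_pi M X x"
proof -
  define g where "g k = prob {\<omega> \<in> space M. Y 0 \<omega> k = Some x}" for k
  have "ennreal (mean_occ x) = (\<integral>\<^sup>+ \<omega>. ennreal (real (exc_occ x 0 \<omega>)) \<partial>M)"
    unfolding mean_occ_def by (intro nn_integral_eq_integral[symmetric] exc_occ_integrable) auto
  also have "\<dots> = (\<integral>\<^sup>+ \<omega>. (\<Sum>k. indicator {\<omega> \<in> space M. Y 0 \<omega> k = Some x} \<omega>) \<partial>M)"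
  proof (rule nn_integral_cong_AE)
    show "AE \<omega> in M. ennreal (real (exc_occ x 0 \<omega>)) = (\<Sum>k. indicator {\<omega> \<in> space M. Y 0 \<omega> k = Some x} \<omega>)"
      using finite_returns AE_space
    proof eventually_elim
      case (elim \<omega>)
      have fin: "\<And>n. tau X n \<omega> \<noteq> \<infinity>" using elim(1) by blast
      let ?K = "{k. k < path_length (Y 0 \<omega>) \<and> Y 0 \<omega> k = Some x}"
      have "(\<Sum>k. indicator {\<omega> \<in> space M. Y 0 \<omega> k = Some x} \<omega> :: ennreal) = (\<Sum>k\<in>?K. 1)"
        using excursion_beyond_length[OF fin, of 0 _ x] elim(2)
        by (subst suminf_finite[of ?K]) (auto simp: indicator_def)
      then show ?case by (simp add: exc_occ_def path_occ_def ennreal_of_nat_eq_real_of_nat)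
    qed
  qed
  also have "\<dots> = (\<Sum>k. \<integral>\<^sup>+ \<omega>. indicator {\<omega> \<in> space M. Y 0 \<omega> k = Some x} \<omega> \<partial>M)"
    by (rule nn_integral_suminf) measurable
  also have "\<dots> = (\<Sum>k. ennreal (g k))"
    by (simp add: g_def emeasure_eq_measure)
  finally have "(\<lambda>k. ennreal (g k)) sums ennreal (mean_occ x)"
    by (metis summable_sums summableI)
  moreover have "mean_occ x \<ge> 0" unfolding mean_occ_def by simp
  ultimately have g_sums: "g sums mean_occ x"
    by (subst (asm) sums_ennreal) (auto simp: g_def)
  have "(\<lambda>m. \<Sum>k\<le>m. g k * renewal_prob (m - k)) \<longlonglongrightarrow> (\<Sum>k. g k) * (1 / mean_length)"
  proof (rule convolution_tendsto[where B = 1 and h = "\<lambda>m. m"])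
    have "\<bar>g k\<bar> = g k" for k by (simp add: g_def)
    then show "summable (\<lambda>k. \<bar>g k\<bar>)" using g_sums by (simp add: sums_iff)
    show "\<bar>renewal_prob n\<bar> \<le> 1" for n using renewal_prob_nonneg[of n] renewal_prob_le_1[of n] by simp
    show "(\<lambda>v. renewal_prob (v - k)) \<longlonglongrightarrow> 1 / mean_length" for k
      by (rule filterlim_compose[OF renewal_prob_tendsto[OF aperiodic] filterlim_minus_const_nat_at_top])
  qed (auto simp: filterlim_ident)
  then have "(\<lambda>m. prob {\<omega> \<in> space M. X (Suc m) \<omega> = x}) \<longlonglongrightarrow> stat_pi M X x"
    using g_sums by (simp add: prob_state_eq g_def[symmetric] stat_pi_eq sums_iff)
  then show ?thesis by (rule LIMSEQ_imp_Suc)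
qed

end

section \<open>Recurrence of the process\<close>

lemma (in lamperti_process) state_reachable:
  assumes "x \<in> S" shows "\<exists>t\<ge>1. prob {\<omega> \<in> space M. X t \<omega> = x} > 0"
proof -
  obtain m \<phi> where m: "\<And>x y. x \<in> S \<Longrightarrow> y \<in> S \<Longrightarrow> 1 \<le> m x y \<and> (0::real) < \<phi> x y"
    and hit: "\<And>y t. y \<in> S \<Longrightarrow> 1 \<le> t \<Longrightarrow> AE \<omega> in M.
                 real_cond_exp M (F t)
                   (indicator {\<omega>' \<in> space M. X (t + m (X t \<omega>') y) \<omega>' = y}) \<omega>
                 \<ge> \<phi> (X t \<omega>) y"
    using A1 by blast
  interpret sigma_finite_subalgebra M "F 1" by (rule sigma_finite_subalgebra_F) simp
  let ?A = "{\<omega>' \<in> space M. X (1 + m (X 1 \<omega>') x) \<omega>' = x}"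
  have A: "?A \<in> sets M" by (rule hit_measurable) simp
  have int: "integrable M (indicator ?A :: 'a \<Rightarrow> real)"
    using A by (intro integrable_real_indicator) (auto simp: emeasure_eq_measure)
  have "\<phi> 0 x = (\<integral>\<omega>. \<phi> 0 x \<partial>M)" by (simp add: prob_space)
  also have "\<dots> \<le> (\<integral>\<omega>. real_cond_exp M (F 1) (indicator ?A) \<omega> \<partial>M)"
  proof (rule integral_mono_AE)
    show "AE \<omega> in M. \<phi> 0 x \<le> real_cond_exp M (F 1) (indicator ?A) \<omega>"
      using hit[OF assms order_refl] start_AE by eventually_elim simp
  qed (use real_cond_exp_int(1)[OF int] in auto)
  also have "\<dots> = prob ?A"
    using real_cond_exp_int(2)[OF int] A by simp
  also have "prob ?A = prob {\<omega> \<in> space M. X (1 + m 0 x) \<omega> = x}"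
  proof (rule finite_measure_eq_AE)
    show "AE \<omega> in M. \<omega> \<in> ?A \<longleftrightarrow> \<omega> \<in> {\<omega> \<in> space M. X (1 + m 0 x) \<omega> = x}"
      using start_AE by eventually_elim simp
    have "X (1 + m 0 x) \<in> borel_measurable M" by (rule X_measurable) simp
    then show "{\<omega> \<in> space M. X (1 + m 0 x) \<omega> = x} \<in> sets M" by measurable
  qed (rule A)
  finally have "prob {\<omega> \<in> space M. X (1 + m 0 x) \<omega> = x} > 0"
    using m[OF S_zero assms] by linarith
  then show ?thesis by (intro exI[of _ "1 + m 0 x"]) auto
qed

lemma (in lamperti_process) all_returns_finite:
  assumes A3b: "\<And>n. 1 \<le> n \<Longrightarrow>
              measure M {\<omega> \<in> space M. eta X (n + 1) \<omega> < \<infinity> \<and> tau X n \<omega> < \<infinity>}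
              = measure M {\<omega> \<in> space M. eta X 1 \<omega> < \<infinity>} * measure M {\<omega> \<in> space M. tau X n \<omega> < \<infinity>}"
  shows "AE \<omega> in M. \<forall>n. tau X n \<omega> \<noteq> \<infinity>"
proof -
  have tau[measurable]: "tau X n \<in> measurable M (count_space UNIV)" for n
    using X_measurable by (rule tau_measurable)
  have eta[measurable]: "eta X n \<in> measurable M (count_space UNIV)" for n
    unfolding eta_def[abs_def] by measurable
  have "AE \<omega> in M. ennreal_of_enat (eta X 1 \<omega>) \<noteq> \<infinity>"
    using expected_return_time_finite by (intro nn_integral_PInf_AE) auto
  then have eta_fin: "AE \<omega> in M. eta X 1 \<omega> < \<infinity>"
    by eventually_elim (metis enat_ord_simps(4) ennreal_of_enat_infty)
  then have eta_1: "prob {\<omega> \<in> space M. eta X 1 \<omega> < \<infinity>} = 1"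
    by (subst prob_Collect_eq_1) measurable
  have "AE \<omega> in M. tau X (Suc n) \<omega> < \<infinity>" for n
  proof (induction n)
    case 0
    show ?case using eta_fin
    proof eventually_elim
      case (elim \<omega>)
      then show ?case unfolding eta_1_eq by (cases "tau X 1 \<omega>") (simp_all del: tau.simps)
    qed
  next
    case (Suc n)
    then have "prob {\<omega> \<in> space M. tau X (Suc n) \<omega> < \<infinity>} = 1"
      by (subst prob_Collect_eq_1) measurable
    then have "prob {\<omega> \<in> space M. eta X (Suc n + 1) \<omega> < \<infinity> \<and> tau X (Suc n) \<omega> < \<infinity>} = 1"
      using A3b[of "Suc n"] eta_1 by simp
    then have "AE \<omega> in M. eta X (Suc n + 1) \<omega> < \<infinity> \<and> tau X (Suc n) \<omega> < \<infinity>"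
      by (subst (asm) prob_Collect_eq_1) measurable
    then show ?case
    proof eventually_elim
      case (elim \<omega>)
      then have "tau X (Suc (Suc n)) \<omega> - tau X (Suc n) \<omega> < \<infinity>" "tau X (Suc n) \<omega> < \<infinity>"
        by (simp_all add: eta_def del: tau.simps)
      then show ?case
        by (cases "tau X (Suc (Suc n)) \<omega>"; cases "tau X (Suc n) \<omega>") (simp_all del: tau.simps)
    qed
  qed
  then have "AE \<omega> in M. \<forall>n. tau X (Suc n) \<omega> < \<infinity>"
    unfolding AE_all_countable by blast
  then show ?thesis
  proof eventually_elim
    case (elim \<omega>)
    show ?case
    proof
      show "tau X n \<omega> \<noteq> \<infinity>" for n
        using elim by (cases n) (auto simp del: tau.simps(2) simp: one_enat_def)
    qed
  qed
qed

lemma Nexc_eq_infinity_iff: "Nexc X \<omega> = \<infinity> \<longleftrightarrow> (\<forall>n\<ge>1. tau X n \<omega> \<noteq> \<infinity>)"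
  unfolding Nexc_def by auto

lemma (in prob_space) uniform_measure_full:
  assumes "A \<in> sets M" "prob A = 1"
  shows "uniform_measure M A = M"
proof (rule measure_eqI)
  fix B assume "B \<in> sets (uniform_measure M A)"
  then have B: "B \<in> sets M" by simp
  have "emeasure M (A \<inter> B) = emeasure M B"
  proof (rule emeasure_eq_AE)
    show "AE x in M. x \<in> A \<inter> B \<longleftrightarrow> x \<in> B"
      using AE_in_set_eq_1[OF assms(1)] assms(2) by auto
  qed (use assms B in auto)
  then show "emeasure (uniform_measure M A) B = emeasure M B"
    using assms B divide_ennreal[of "prob B" 1] by (simp add: emeasure_eq_measure)
qed simp

theorem theorem2p6:
  fixes M :: "'a measure" and F :: "nat \<Rightarrow> 'a measure"
    and X :: "nat \<Rightarrow> 'a \<Rightarrow> real" and S :: "real set"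
    and c s2 p :: real
  assumes prob: "prob_space M"
    \<comment> \<open>(A0)\<close>
    and S_nonneg: "S \<subseteq> {0..}"
    and S_locfin: "\<And>b. finite (S \<inter> {..b})"
    and S_unbdd: "\<not> bdd_above S"
    and S_zero: "0 \<in> S"
    and filt_sub: "\<And>t. 1 \<le> t \<Longrightarrow> subalgebra M (F t)"
    and filt_mono: "\<And>s t. 1 \<le> s \<Longrightarrow> s \<le> t \<Longrightarrow> sets (F s) \<subseteq> sets (F t)"
    and adapted: "\<And>t. 1 \<le> t \<Longrightarrow> X t \<in> borel_measurable (F t)"
    and S_valued: "\<And>t \<omega>. 1 \<le> t \<Longrightarrow> \<omega> \<in> space M \<Longrightarrow> X t \<omega> \<in> S"
    and start: "measure M {\<omega> \<in> space M. X 1 \<omega> = 0} = 1"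
    \<comment> \<open>(A1)\<close>
    and A1: "\<exists>(m :: real \<Rightarrow> real \<Rightarrow> nat) (\<phi> :: real \<Rightarrow> real \<Rightarrow> real).
              (\<forall>x\<in>S. \<forall>y\<in>S. 1 \<le> m x y \<and> 0 < \<phi> x y) \<and>
              (\<forall>y\<in>S. \<forall>t\<ge>1. AE \<omega> in M.
                 real_cond_exp M (F t)
                   (indicator {\<omega>' \<in> space M. X (t + m (X t \<omega>') y) \<omega>' = y}) \<omega>
                 \<ge> \<phi> (X t \<omega>) y)"
    \<comment> \<open>(A2)\<close>
    and s2_pos: "0 < s2"
    and Delta_L2: "\<And>t. 1 \<le> t \<Longrightarrow> integrable M (\<lambda>\<omega>. (X (t + 1) \<omega> - X t \<omega>)\<^sup>2)"
    and A2_mean: "\<And>\<epsilon>. 0 < \<epsilon> \<Longrightarrow> \<exists>x0. \<forall>t\<ge>1. AE \<omega> in M. X t \<omega> \<ge> x0 \<longrightarrow>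
              \<bar>real_cond_exp M (F t) (\<lambda>\<omega>'. X (t + 1) \<omega>' - X t \<omega>') \<omega> - c / X t \<omega>\<bar>
                \<le> \<epsilon> / (X t \<omega> * ln (X t \<omega>))"
    and A2_var: "\<And>\<epsilon>. 0 < \<epsilon> \<Longrightarrow> \<exists>x0. \<forall>t\<ge>1. AE \<omega> in M. X t \<omega> \<ge> x0 \<longrightarrow>
              \<bar>real_cond_exp M (F t) (\<lambda>\<omega>'. (X (t + 1) \<omega>' - X t \<omega>')\<^sup>2) \<omega> - s2\<bar>
                \<le> \<epsilon> / ln (X t \<omega>)"
    \<comment> \<open>(A3)\<close>
    and A3a: "emeasure M {\<omega> \<in> space M. Nexc X \<omega> = \<infinity>} > 0 \<Longrightarrow>
              (let M' = uniform_measure M {\<omega> \<in> space M. Nexc X \<omega> = \<infinity>} in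
                 prob_space.indep_vars M' (\<lambda>_. path_space) (excursion X) {1..} \<and>
                 (\<forall>n\<ge>1. distr M' path_space (excursion X n) = distr M' path_space (excursion X 1)))"
    and A3b: "\<And>n. 1 \<le> n \<Longrightarrow>
              measure M {\<omega> \<in> space M. eta X (n + 1) \<omega> < \<infinity> \<and> tau X n \<omega> < \<infinity>}
              = measure M {\<omega> \<in> space M. eta X 1 \<omega> < \<infinity>} * measure M {\<omega> \<in> space M. tau X n \<omega> < \<infinity>}"
    \<comment> \<open>r > 1 with r = -2c/s2, and (M_p) with p > 1 + r\<close>
    and r_gt: "- 2 * c / s2 > 1"
    and p_gt: "p > 1 + (- 2 * c / s2)"
    and Mp: "\<exists>\<delta>>0. \<exists>C::real. \<forall>t\<ge>1. AE \<omega> in M.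
              nn_cond_exp M (F t) (\<lambda>\<omega>'. ennreal (\<bar>X (t + 1) \<omega>' - X t \<omega>'\<bar> powr p)) \<omega>
                \<le> ennreal (C * (1 + X t \<omega>) powr (p - 2 - \<delta>))"
  shows "(\<forall>x\<in>S. stat_pi M X x > 0)
       \<and> (stat_pi M X has_sum 1) S
       \<and> (\<forall>x\<in>S. (AE \<omega> in M. (\<lambda>t. real (occ X t x \<omega>) / real t) \<longlonglongrightarrow> stat_pi M X x)
                 \<and> (\<forall>q::real\<ge>1. (\<lambda>t. \<integral>\<^sup>+ \<omega>. ennreal (\<bar>real (occ X t x \<omega>) / real t - stat_pi M X x\<bar> powr q) \<partial>M)
                                  \<longlonglongrightarrow> 0))
       \<and> ((\<forall>k::nat>1. measure M {\<omega> \<in> space M. eta X 1 \<omega> \<in> enat ` {k * j | j. 1 \<le> j}} \<noteq> 1) \<longrightarrow>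
            (\<forall>x\<in>S. (\<lambda>t. measure M {\<omega> \<in> space M. X t \<omega> = x}) \<longlonglongrightarrow> stat_pi M X x))"
proof -
  interpret prob_space M by (rule prob)
  interpret lamperti_process M F X S c s2 p
    by unfold_locales (fact S_nonneg S_locfin S_zero filt_sub filt_mono adapted S_valued start A1
      s2_pos Delta_L2 A2_mean A2_var r_gt p_gt Mp)+
  have returns: "AE \<omega> in M. \<forall>n. tau X n \<omega> \<noteq> \<infinity>"
    using A3b by (rule all_returns_finite)
  let ?N = "{\<omega> \<in> space M. Nexc X \<omega> = \<infinity>}"
  have [measurable]: "tau X n \<in> measurable M (count_space UNIV)" for n
    using X_measurable by (rule tau_measurable)
  have N: "?N \<in> sets M" unfolding Nexc_eq_infinity_iff by measurable
  have "AE \<omega> in M. Nexc X \<omega> = \<infinity>"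
    using returns by eventually_elim (simp add: Nexc_eq_infinity_iff)
  then have N1: "prob ?N = 1"
    using N by (subst prob_Collect_eq_1) auto
  then have "emeasure M ?N > 0" by (simp add: emeasure_eq_measure)
  from A3a[OF this] have iid: "indep_vars (\<lambda>_. path_space) (excursion X) {1..}"
      "\<And>n. n \<ge> 1 \<Longrightarrow> distr M path_space (excursion X n) = distr M path_space (excursion X 1)"
    unfolding Let_def uniform_measure_full[OF N N1] by blast+
  have "range Suc = {1..}" by (auto simp: image_iff Suc_le_eq gr0_conv_Suc)
  then have indep: "indep_vars (\<lambda>_. path_space) (\<lambda>n. excursion X (Suc n)) UNIV"
    using iid(1) by (intro indep_vars_reindex[of Suc UNIV "\<lambda>_. path_space" "excursion X"]) auto
  have ident: "distr M path_space (excursion X (Suc n)) = distr M path_space (excursion X 1)" for n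
    by (rule iid(2)) simp
  have S_infinite: "infinite S"
    using S_unbdd by (auto intro: bdd_above_finite)
  interpret iid_excursions M X S
    by unfold_locales (fact X_measurable S_valued countable_S S_infinite returns indep ident
      expected_return_time_finite state_reachable)+
  show ?thesis
    by (intro conjI ballI allI impI stat_pi_pos stat_pi_has_sum occ_average_AE occ_average_Lq state_tendsto)
       blast+
qed

end
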